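(* Let $\mathbb{G}$ be a homogeneous group of homogeneous dimension $Q\geq 2$, let $|\cdot|$ be an arbitrary homogeneous quasi-norm on $\mathbb{G}$, and let $R>0$. Then for each $f\in C_{0}^{\infty}(B(0,R)\setminus\{0\})$, $$\left(\int_{B(0,R)}\left|(\log|x|)\,\mathcal{R}f\right|^{Q}dx\right)^{\frac1Q}\left(\int_{B(0,R)}|x|^{\frac{Q}{Q-1}}|f|^{\frac{Q}{Q-1}}dx\right)^{\frac{Q-1}{Q}}\geq\frac1Q\int_{B(0,R)}|f|^{2}dx.$$
   Context: A homogeneous group $\mathbb{G}$ is a connected simply connected Lie group whose Lie algebra $\mathfrak{g}$ is equipped with a family of dilations $D_{\lambda}=\mathrm{Exp}(A\ln\lambda)=\sum_{k\ge 0}\frac{1}{k!}(\ln(\lambda)A)^{k}$, $\lambda>0$, where $A$ is a diagonalisable linear operator on $\mathfrak{g}$ with positive eigenvalues and each $D_{\lambda}$ is a Lie algebra morphism. Such a group is nilpotent, the exponential map $\mathfrak{g}\to\mathbb{G}$ is a global diffeomorphism, and the dilations are transported to $\mathbb{G}$ via it; write $\lambda x:=D_{\lambda}x$ for $x\in\mathbb{G}$. The unit element of $\mathbb{G}$ is denoted $0$. The homogeneous dimension is $Q=\mathrm{Tr}\,A$, and $dx$ denotes Haar measure. A homogeneous quasi-norm is a continuous function $|\cdot|:\mathbb{G}\to[0,\infty)$ with $|x^{-1}|=|x|$, $|\lambda x|=\lambda|x|$ for all $x\in\mathbb{G}$, $\lambda>0$, and $|x|=0$ if and only if $x=0$. $B(0,R)=\{x\in\mathbb{G}:|x|<R\}$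 is the quasi-ball with respect to $|\cdot|$. The radial operator $\mathcal{R}=\frac{d}{d|x|}$ is defined by $\mathcal{R}f(x)=\frac{d}{dr}f(D_{r}y)\big|_{r=|x|}$, where $y=D_{1/|x|}x$ (so $|y|=1$). Functions are complex-valued. *)

theory Defs
  imports "HOL-Analysis.Analysis"
begin

section \<open>Smooth maps and smooth manifolds\<close>

text \<open>Meaningful for open \<open>S\<close> only.\<close>

fun C_k_on :: "nat \<Rightarrow> 'a::euclidean_space set \<Rightarrow> ('a \<Rightarrow> 'b::real_normed_vector) \<Rightarrow> bool" where
  "C_k_on 0 S f \<longleftrightarrow> continuous_on S f"
| "C_k_on (Suc k) S f \<longleftrightarrow>
     (\<forall>x\<in>S. f differentiable (at x)) \<and> (\<forall>v. C_k_on k S (\<lambda>x. frechet_derivative f (at x) v))"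

definition smooth_on :: "'a::euclidean_space set \<Rightarrow> ('a \<Rightarrow> 'b::real_normed_vector) \<Rightarrow> bool" where
  "smooth_on S f \<longleftrightarrow> (\<forall>k. C_k_on k S f)"

text \<open>A chart is a pair of its domain and the coordinate map, which is arbitrary outside the domain.\<close>

type_synonym ('x, 'e) atlas = "('x set \<times> ('x \<Rightarrow> 'e)) set"

definition smooth_atlas :: "('x::topological_space, 'e::euclidean_space) atlas \<Rightarrow> bool" where
  "smooth_atlas \<A> \<longleftrightarrow>
     (\<Union>(U, \<phi>)\<in>\<A>. U) = UNIV \<and>
     (\<forall>(U, \<phi>)\<in>\<A>. open U \<and> open (\<phi> ` U) \<and> homeomorphism U (\<phi> ` U) \<phi> (inv_into U \<phi>)) \<and>
     (\<forall>(U, \<phi>)\<in>\<A>. \<forall>(V, \<psi>)\<in>\<A>. smooth_on (\<phi> ` (U \<inter> V)) (\<psi> \<circ> inv_into U \<phi>))"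

definition standard_atlas :: "('e, 'e::euclidean_space) atlas" where
  "standard_atlas = {(UNIV, id)}"

definition product_atlas ::
  "('x, 'd) atlas \<Rightarrow> ('y, 'e) atlas \<Rightarrow> ('x \<times> 'y, 'd \<times> 'e) atlas" where
  "product_atlas \<A> \<B> = {(U \<times> V, map_prod \<phi> \<psi>) | U \<phi> V \<psi>. (U, \<phi>) \<in> \<A> \<and> (V, \<psi>) \<in> \<B>}"

definition smooth_map ::
  "('x::topological_space, 'd::euclidean_space) atlas \<Rightarrow>
   ('y::topological_space, 'e::euclidean_space) atlas \<Rightarrow> ('x \<Rightarrow> 'y) \<Rightarrow> bool" where
  "smooth_map \<A> \<B> F \<longleftrightarrow> continuous_on UNIV F \<and>
     (\<forall>(U, \<phi>)\<in>\<A>. \<forall>(V, \<psi>)\<in>\<B>.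
        smooth_on (\<phi> ` (U \<inter> F -` V)) (\<psi> \<circ> F \<circ> inv_into U \<phi>))"

abbreviation smooth_fun ::
  "('x::topological_space, 'd::euclidean_space) atlas \<Rightarrow> ('x \<Rightarrow> 'e::euclidean_space) \<Rightarrow> bool" where
  "smooth_fun \<A> f \<equiv> smooth_map \<A> standard_atlas f"


section \<open>Lie groups, their Lie algebra and exponential map\<close>

text \<open>Groups are written additively, following the notation \<open>0\<close> for the unit of
  \<open>\<bbbG>\<close>; the class \<open>group_add\<close> does not include commutativity. So \<open>x + y\<close> is the
  product and \<open>- x\<close> the inverse.\<close>

locale lie_group =
  fixes \<A> :: "('g::{topological_group_add, t2_space, second_countable_topology},
               'v::euclidean_space) atlas"
  assumes atlas: "smooth_atlas \<A>"
    and smooth_mult: "smooth_map (product_atlas \<A> \<A>) \<A> (\<lambda>(x, y). x + y)"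
    and smooth_inverse: "smooth_map \<A> \<A> uminus"

text \<open>Left-invariant vector fields, as derivations of the algebra of real smooth functions.
  The last clause only fixes the irrelevant values on non-smooth functions, so that a vector
  field is represented by exactly one operator.\<close>

definition left_invariant_field ::
  "('g::topological_group_add, 'v::euclidean_space) atlas \<Rightarrow>
   (('g \<Rightarrow> real) \<Rightarrow> ('g \<Rightarrow> real)) \<Rightarrow> bool" where
  "left_invariant_field \<A> X \<longleftrightarrow>
     (\<forall>f. smooth_fun \<A> f \<longrightarrow> smooth_fun \<A> (X f)) \<and>
     (\<forall>f g a b. smooth_fun \<A> f \<longrightarrow> smooth_fun \<A> g \<longrightarrow>
        X (\<lambda>x. a * f x + b * g x) = (\<lambda>x. a * X f x + b * X g x)) \<and>
     (\<forall>f g. smooth_fun \<A> f \<longrightarrow> smooth_fun \<A> g \<longrightarrow>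
        X (\<lambda>x. f x * g x) = (\<lambda>x. X f x * g x + f x * X g x)) \<and>
     (\<forall>f z. smooth_fun \<A> f \<longrightarrow> X (\<lambda>x. f (z + x)) = (\<lambda>x. X f (z + x))) \<and>
     (\<forall>f. \<not> smooth_fun \<A> f \<longrightarrow> X f = (\<lambda>_. 0))"

text \<open>The Lie algebra is carried by the vector space \<open>'v\<close>: \<open>L\<close> is a linear isomorphism of
  \<open>'v\<close> onto the space of left-invariant vector fields. The inner product of \<open>'v\<close> plays no role.\<close>

definition lie_algebra_iso ::
  "('g::topological_group_add, 'v::euclidean_space) atlas \<Rightarrow>
   ('v \<Rightarrow> ('g \<Rightarrow> real) \<Rightarrow> ('g \<Rightarrow> real)) \<Rightarrow> bool" where
  "lie_algebra_iso \<A> L \<longleftrightarrow>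
     bij_betw L UNIV {X. left_invariant_field \<A> X} \<and>
     (\<forall>u v. L (u + v) = (\<lambda>f x. L u f x + L v f x)) \<and>
     (\<forall>c v. L (c *\<^sub>R v) = (\<lambda>f x. c * L v f x))"

definition lie_bracket :: "('v \<Rightarrow> ('g \<Rightarrow> real) \<Rightarrow> ('g \<Rightarrow> real)) \<Rightarrow> 'v \<Rightarrow> 'v \<Rightarrow> 'v" where
  "lie_bracket L u v = inv L (\<lambda>f x. L u (L v f) x - L v (L u f) x)"

text \<open>\<open>E\<close> is the exponential map: for every \<open>v\<close>, the curve \<open>t \<mapsto> E (t v)\<close> is the
  (unique) one-parameter subgroup with velocity \<open>v\<close> at the unit.\<close>

definition exponential_map ::
  "('g::topological_group_add, 'v::euclidean_space) atlas \<Rightarrow>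
   ('v \<Rightarrow> ('g \<Rightarrow> real) \<Rightarrow> ('g \<Rightarrow> real)) \<Rightarrow> ('v \<Rightarrow> 'g) \<Rightarrow> bool" where
  "exponential_map \<A> L E \<longleftrightarrow>
     (\<forall>v. smooth_map standard_atlas \<A> (\<lambda>t::real. E (t *\<^sub>R v)) \<and>
          (\<forall>s t. E ((s + t) *\<^sub>R v) = E (s *\<^sub>R v) + E (t *\<^sub>R v)) \<and>
          (\<forall>f. smooth_fun \<A> f \<longrightarrow>
             ((\<lambda>t. f (E (t *\<^sub>R v))) has_real_derivative L v f 0) (at 0)))"


section \<open>Homogeneous groups\<close>

definition diagonalisable_pos :: "('v::euclidean_space \<Rightarrow> 'v) \<Rightarrow> bool" where
  "diagonalisable_pos A \<longleftrightarrow>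
     (\<exists>B. independent B \<and> span B = UNIV \<and> (\<forall>b\<in>B. \<exists>\<mu>>0. A b = \<mu> *\<^sub>R b))"

text \<open>\<open>D\<^sub>s = Exp (A ln s)\<close> on the Lie algebra.\<close>

definition alg_dilation :: "('v::euclidean_space \<Rightarrow> 'v) \<Rightarrow> real \<Rightarrow> 'v \<Rightarrow> 'v" where
  "alg_dilation A s v = (\<Sum>k. (1 / fact k) *\<^sub>R ((\<lambda>w. ln s *\<^sub>R A w) ^^ k) v)"

definition homogeneous_dimension :: "('v::euclidean_space \<Rightarrow> 'v) \<Rightarrow> real" where
  "homogeneous_dimension A = (\<Sum>b\<in>Basis. A b \<bullet> b)"

text \<open>The assumptions on \<open>E\<close> being a global diffeomorphism are a known consequence of the
  remaining ones; they are part of the structure since they are what allows the dilations to be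
  transported to the group.\<close>

locale homogeneous_group = lie_group \<A>
  for \<A> :: "('g::{topological_group_add, t2_space, second_countable_topology},
             'v::euclidean_space) atlas" +
  fixes L :: "'v \<Rightarrow> ('g \<Rightarrow> real) \<Rightarrow> ('g \<Rightarrow> real)"
    and E :: "'v \<Rightarrow> 'g"
    and A :: "'v \<Rightarrow> 'v"
  assumes connected_group: "connected (UNIV :: 'g set)"
    and simply_connected_group: "simply_connected (UNIV :: 'g set)"
    and lie_algebra: "lie_algebra_iso \<A> L"
    and exponential: "exponential_map \<A> L E"
    and exp_bij: "bij E"
    and exp_smooth: "smooth_map standard_atlas \<A> E"
    and log_smooth: "smooth_map \<A> standard_atlas (inv E)"
    and linear_A: "linear A"
    and diagonalisable_A: "diagonalisable_pos A"
    and dilation_morphism: "\<And>s. s > 0 \<Longrightarrow> linear (alg_dilation A s) \<and>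
      (\<forall>u v. alg_dilation A s (lie_bracket L u v) =
             lie_bracket L (alg_dilation A s u) (alg_dilation A s v))"

definition dilation :: "('v::euclidean_space \<Rightarrow> 'g) \<Rightarrow> ('v \<Rightarrow> 'v) \<Rightarrow> real \<Rightarrow> 'g \<Rightarrow> 'g" where
  "dilation E A s x = E (alg_dilation A s (inv E x))"

definition homogeneous_quasi_norm ::
  "('v::euclidean_space \<Rightarrow> 'g::topological_group_add) \<Rightarrow> ('v \<Rightarrow> 'v) \<Rightarrow> ('g \<Rightarrow> real) \<Rightarrow> bool" where
  "homogeneous_quasi_norm E A N \<longleftrightarrow>
     continuous_on UNIV N \<and> (\<forall>x. N x \<ge> 0) \<and> (\<forall>x. N (- x) = N x) \<and>
     (\<forall>x. \<forall>s>0. N (dilation E A s x) = s * N x) \<and> (\<forall>x. N x = 0 \<longleftrightarrow> x = 0)"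

definition quasi_ball :: "('g \<Rightarrow> real) \<Rightarrow> real \<Rightarrow> 'g set" where
  "quasi_ball N R = {x. N x < R}"

text \<open>The value at \<open>x = 0\<close>, where the operator is undefined, is arbitrary.\<close>

definition radial_deriv ::
  "('v::euclidean_space \<Rightarrow> 'g) \<Rightarrow> ('v \<Rightarrow> 'v) \<Rightarrow> ('g \<Rightarrow> real) \<Rightarrow> ('g \<Rightarrow> complex) \<Rightarrow> 'g \<Rightarrow> complex" where
  "radial_deriv E A N f x =
     (let y = dilation E A (1 / N x) x
      in vector_derivative (\<lambda>r. f (dilation E A r y)) (at (N x)))"

text \<open>Left Haar measure. Finiteness on compact sets suffices for regularity since the groups
  considered are locally compact and second countable.\<close>

definition haar_measure :: "'g::topological_group_add measure \<Rightarrow> bool" where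
  "haar_measure M \<longleftrightarrow> sets M = sets borel \<and> emeasure M UNIV \<noteq> 0 \<and>
     (\<forall>K. compact K \<longrightarrow> emeasure M K < \<infinity>) \<and>
     (\<forall>x. \<forall>B\<in>sets borel. emeasure M ((\<lambda>y. x + y) ` B) = emeasure M B)"

text \<open>\<open>C\<^sub>0\<^sup>\<infinity>(\<Omega>)\<close>, its elements being extended by zero to the whole group.\<close>

definition test_function ::
  "('g::topological_space, 'v::euclidean_space) atlas \<Rightarrow> 'g set \<Rightarrow> ('g \<Rightarrow> complex) \<Rightarrow> bool" where
  "test_function \<A> \<Omega> f \<longleftrightarrow>
     smooth_fun \<A> f \<and> compact (closure {x. f x \<noteq> 0}) \<and> closure {x. f x \<noteq> 0} \<subseteq> \<Omega>"

end

theory Submission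
  imports Defs
begin

text \<open>Fix \<open>f\<close> and write \<open>X = |x| \<R>\<close> for the Euler operator, the derivative of \<open>f (s x)\<close> at
  \<open>s = 1\<close>. Since Haar measure scales by \<open>s\<^sup>Q\<close> under dilations, \<open>\<integral> X g = - Q \<integral> g\<close>. For
  \<open>g = |f|\<^sup>Q |x|\<^bsup>-Q\<^esup> log |x|\<close> the terms with \<open>Q g\<close> cancel and leave
  \<open>\<integral> |f|\<^sup>Q |x|\<^bsup>-Q\<^esup> = - \<integral> X(|f|\<^sup>Q) |x|\<^bsup>-Q\<^esup> log |x|\<close>, so Hoelder's inequality gives the critical Hardy
  inequality \<open>\<parallel>f / |x|\<parallel>\<^sub>Q \<le> Q \<parallel>log |x| \<R> f\<parallel>\<^sub>Q\<close>; one more application of Hoelder's inequality to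
  \<open>|f|\<^sup>2 = (|f| / |x|) (|x| |f|)\<close> finishes the proof.

  The scaling of Haar measure holds because Lebesgue measure in exponential coordinates is
  left-invariant, and Haar measure is unique. In these coordinates let \<open>P x\<close> map a vector to the
  value at \<open>x\<close> of the corresponding left-invariant field. Left translations have Jacobian
  \<open>det P(x y) / det P(y)\<close>. Along rays \<open>t P(t x)\<^sup>-\<^sup>1\<close> solves the linear equation \<open>K' = 1 - ad x K\<close>,
  which commutes with the dilations; hence \<open>det P\<close> is constant on dilation orbits, and as these
  accumulate at the unit, \<open>det P = 1\<close>.\<close>

subsection \<open>Smooth maps\<close>

text \<open>The exponent \<open>Q\<close> is critical. The Euler derivative of \<open>|x|\<close> to
  the power \<open>-Q\<close> is \<open>-Q\<close> times itself, which exactly balances the Jacobian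
  of the dilations, so a pure power as weight yields only that a certain integral vanishes. The
  logarithm, whose Euler derivative is 1, leaves the one surviving term. The constant
  \<open>Q\<close> of the Hardy inequality comes from differentiating \<open>|f|\<close> to the
  power \<open>Q\<close>.

  The quasi-norm is merely continuous. This is harmless because \<open>g\<close> is differentiated
  only along dilation orbits, on which \<open>N\<close> is linear in the parameter. A support that
  is compact and avoids the unit keeps weight and logarithm bounded.

  The obstacle is the geometry behind the scaling of Haar measure. Invariance of that measure
  concerns translations of the group, whereas the dilations are given as automorphisms of the Lie
  algebra. The equation along rays has coefficients that depend on the bracket alone, and so it
  carries the symmetry from the algebra to the fields on the group.\<close>

lemma C_k_on_subset:
  assumes "C_k_on k S f" "T \<subseteq> S"
  shows "C_k_on k T f"
  using assms
proof (induction k arbitrary: f)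
  case 0
  then show ?case by (auto intro: continuous_on_subset)
next
  case (Suc k)
  then show ?case by auto
qed

lemma C_k_on_SucD:
  assumes "C_k_on (Suc k) S f"
  shows "C_k_on k S f"
  using assms
proof (induction k arbitrary: f)
  case 0
  then show ?case
    by (auto intro!: continuous_at_imp_continuous_on differentiable_imp_continuous_within)
next
  case (Suc k)
  then show ?case by auto
qed

lemma C_k_on_cong:
  assumes "open S" "\<And>x. x \<in> S \<Longrightarrow> f x = g x"
  shows "C_k_on k S f \<longleftrightarrow> C_k_on k S g"
  using assms
proof (induction k arbitrary: f g)
  case 0
  then show ?case by (auto intro: continuous_on_cong)
next
  case (Suc k)
  have *: "(f has_derivative D) (at x) \<longleftrightarrow> (g has_derivative D) (at x)" if "x \<in> S" for x D
    using Suc.prems that has_derivative_transform_within_open[of f D x UNIV S g]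
      has_derivative_transform_within_open[of g D x UNIV S f] by auto
  have d: "f differentiable (at x) \<longleftrightarrow> g differentiable (at x)" if "x \<in> S" for x
    using *[OF that] by (simp add: differentiable_def)
  have fd: "frechet_derivative f (at x) = frechet_derivative g (at x)" if "x \<in> S" for x
    using *[OF that] by (simp add: frechet_derivative_def)
  have "C_k_on k S (\<lambda>x. frechet_derivative f (at x) v) \<longleftrightarrow>
        C_k_on k S (\<lambda>x. frechet_derivative g (at x) v)" for v
    using Suc.prems by (intro Suc.IH) (auto simp: fd)
  then show ?case using d by auto
qed

text \<open>Each closure property below follows by induction on the order, using the derivative that
  its differentiation rule provides; this replaces the chosen \<open>frechet_derivative\<close> by
  that explicit one.\<close>

lemma C_k_on_Suc_iff:
  assumes "open S" "\<And>x. x \<in> S \<Longrightarrow> (f has_derivative f' x) (at x)"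
  shows "C_k_on (Suc k) S f \<longleftrightarrow> (\<forall>v. C_k_on k S (\<lambda>x. f' x v))"
proof -
  have "C_k_on k S (\<lambda>x. frechet_derivative f (at x) v) \<longleftrightarrow> C_k_on k S (\<lambda>x. f' x v)" for v
    using assms by (intro C_k_on_cong) (metis frechet_derivative_at)+
  then show ?thesis using assms by (auto simp: differentiable_def)
qed

lemma C_k_on_SucE:
  assumes "C_k_on (Suc k) S f" "x \<in> S"
  shows "(f has_derivative frechet_derivative f (at x)) (at x)"
  using assms by (auto simp: frechet_derivative_works)

lemma C_k_on_const: "open S \<Longrightarrow> C_k_on k S (\<lambda>x. c)"
proof (induction k arbitrary: c)
  case (Suc k)
  then show ?case by (subst C_k_on_Suc_iff[where f' = "\<lambda>x v. 0"]) auto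
qed auto

lemma C_k_on_bounded_linear:
  assumes "open S" "bounded_linear T" "C_k_on k S f"
  shows "C_k_on k S (\<lambda>x. T (f x))"
  using assms(3)
proof (induction k arbitrary: f)
  case 0
  then show ?case using assms(2) by (auto intro: bounded_linear.continuous_on)
next
  case (Suc k)
  show ?case
    using Suc.prems
    by (subst C_k_on_Suc_iff[where f' = "\<lambda>x v. T (frechet_derivative f (at x) v)", OF assms(1)])
       (auto intro!: bounded_linear.has_derivative[OF assms(2)] C_k_on_SucE Suc.IH)
qed

lemma C_k_on_id: "open S \<Longrightarrow> C_k_on k S (\<lambda>x. x)"
proof (cases k)
  case (Suc j)
  assume "open S"
  then show ?thesis unfolding Suc
    by (subst C_k_on_Suc_iff[where f' = "\<lambda>x v. v"]) (auto intro: C_k_on_const)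
qed auto

lemma C_k_on_add:
  assumes "open S" "C_k_on k S f" "C_k_on k S g"
  shows "C_k_on k S (\<lambda>x. f x + g x)"
  using assms(2,3)
proof (induction k arbitrary: f g)
  case 0
  then show ?case by (auto intro: continuous_intros)
next
  case (Suc k)
  show ?case
    using Suc.prems
    by (subst C_k_on_Suc_iff[where f' = "\<lambda>x v. frechet_derivative f (at x) v +
           frechet_derivative g (at x) v", OF assms(1)])
       (auto intro!: has_derivative_add C_k_on_SucE Suc.IH)
qed

lemma C_k_on_sum:
  assumes "open S" "\<And>i. i \<in> I \<Longrightarrow> C_k_on k S (f i)"
  shows "C_k_on k S (\<lambda>x. \<Sum>i\<in>I. f i x)"
proof (cases "finite I")
  case True
  then show ?thesis using assms(2)
    by (induction I rule: finite_induct) (auto intro: C_k_on_const C_k_on_add assms(1))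
qed (auto intro: C_k_on_const assms(1))

lemma C_k_on_bilinear:
  assumes "open S" "bounded_bilinear B" "C_k_on k S f" "C_k_on k S g"
  shows "C_k_on k S (\<lambda>x. B (f x) (g x))"
  using assms(3,4)
proof (induction k arbitrary: f g)
  case 0
  then show ?case using assms(2) by (auto intro: bounded_bilinear.continuous_on)
next
  case (Suc k)
  show ?case
    using Suc.prems
    by (subst C_k_on_Suc_iff[where f' = "\<lambda>x v. B (f x) (frechet_derivative g (at x) v) +
           B (frechet_derivative f (at x) v) (g x)", OF assms(1)])
       (auto intro!: bounded_bilinear.FDERIV[OF assms(2)] C_k_on_SucE C_k_on_add assms(1) Suc.IH
             simp del: C_k_on.simps dest: C_k_on_SucD, auto)
qed

lemma C_k_on_Pair:
  assumes "open S" "C_k_on k S f" "C_k_on k S g"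
  shows "C_k_on k S (\<lambda>x. (f x, g x))"
  using assms(2,3)
proof (induction k arbitrary: f g)
  case 0
  then show ?case by (auto intro: continuous_intros)
next
  case (Suc k)
  show ?case
    using Suc.prems
    by (subst C_k_on_Suc_iff[where f' = "\<lambda>x v. (frechet_derivative f (at x) v,
           frechet_derivative g (at x) v)", OF assms(1)])
       (auto intro!: has_derivative_Pair C_k_on_SucE Suc.IH)
qed

text \<open>In the chain rule both the outer derivative and the direction it is applied to vary with
  \<open>x\<close>, while \<open>C_k_on\<close> controls derivatives in fixed directions only.
  Expanding the direction in \<open>Basis\<close> leaves sums of products of maps of order
  \<open>k\<close>.\<close>

lemma C_k_on_compose:
  fixes f :: "'a::euclidean_space \<Rightarrow> 'b::euclidean_space"
  assumes "open S" "open T" "f ` S \<subseteq> T" "C_k_on k S f" "C_k_on k T g"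
  shows "C_k_on k S (\<lambda>x. g (f x))"
  using assms(4,5)
proof (induction k arbitrary: g)
  case 0
  then show ?case using assms(3) by (auto intro: continuous_on_compose2)
next
  case (Suc k)
  have T: "f x \<in> T" if "x \<in> S" for x using assms(3) that by auto
  have lin: "frechet_derivative g (at (f x)) w =
     (\<Sum>b\<in>Basis. (w \<bullet> b) *\<^sub>R frechet_derivative g (at (f x)) b)" if "x \<in> S" for x w
  proof -
    have l: "linear (frechet_derivative g (at (f x)))"
      using C_k_on_SucE[OF Suc.prems(2) T[OF that]] has_derivative_linear by blast
    show ?thesis
      by (subst euclidean_representation[symmetric, of w])
         (simp only: linear_sum[OF l] linear_cmul[OF l])
  qed
  have 1: "((\<lambda>x. g (f x)) has_derivative
      (\<lambda>v. frechet_derivative g (at (f x)) (frechet_derivative f (at x) v))) (at x)" if "x \<in> S" for x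
    using C_k_on_SucE[OF Suc.prems(1) that] C_k_on_SucE[OF Suc.prems(2) T[OF that]]
    by (rule has_derivative_compose)
  have "C_k_on k S (\<lambda>x. \<Sum>b\<in>Basis. (frechet_derivative f (at x) v \<bullet> b) *\<^sub>R
           frechet_derivative g (at (f x)) b)" for v
    using Suc.prems C_k_on_SucD[OF Suc.prems(1)]
    by (intro C_k_on_sum C_k_on_bilinear[OF _ bounded_bilinear_scaleR] assms(1)
        C_k_on_bounded_linear[OF _ bounded_linear_inner_left] Suc.IH) auto
  then have "C_k_on k S (\<lambda>x. frechet_derivative g (at (f x)) (frechet_derivative f (at x) v))" for v
    by (subst C_k_on_cong[OF assms(1) lin]) auto
  then show ?case by (subst C_k_on_Suc_iff[OF assms(1) 1]) auto
qed

text \<open>Derivatives are taken with \<open>at x\<close> in the whole space, so they are local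
  already; only continuity, at order 0, has to be glued.\<close>

lemma C_k_on_local:
  assumes "\<And>x. x \<in> S \<Longrightarrow> \<exists>T. open T \<and> x \<in> T \<and> C_k_on k (S \<inter> T) f"
  shows "C_k_on k S f"
  using assms
proof (induction k arbitrary: f)
  case 0
  have "continuous (at x within S) f" if "x \<in> S" for x
  proof -
    obtain T where T: "open T" "x \<in> T" "continuous_on (S \<inter> T) f" using 0[OF \<open>x \<in> S\<close>] by auto
    then have "continuous (at x within S \<inter> T) f"
      using \<open>x \<in> S\<close> by (auto simp: continuous_on_eq_continuous_within)
    moreover have "at x within S = at x within S \<inter> T"
      by (rule at_within_nhd[OF T(2,1)]) auto
    ultimately show ?thesis by simp
  qed
  then show ?case by (auto simp: continuous_on_eq_continuous_within)
next
  case (Suc k)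
  have "C_k_on k S (\<lambda>x. frechet_derivative f (at x) v)" for v
      proof (rule Suc.IH)
    fix x assume "x \<in> S"
    from Suc.prems[OF this]
    show "\<exists>T. open T \<and> x \<in> T \<and> C_k_on k (S \<inter> T) (\<lambda>x. frechet_derivative f (at x) v)" by auto
  qed
  moreover have "f differentiable at x" if "x \<in> S" for x
    using Suc.prems[OF that] that by auto
  ultimately show ?case by auto
qed

lemma smooth_on_D: "smooth_on S f \<Longrightarrow> C_k_on k S f"
  by (simp add: smooth_on_def)

lemma smooth_on_compose:
  fixes f :: "'a::euclidean_space \<Rightarrow> 'b::euclidean_space"
  assumes "open S" "open T" "f ` S \<subseteq> T" "smooth_on S f" "smooth_on T g"
  shows "smooth_on S (\<lambda>x. g (f x))"
  using assms C_k_on_compose unfolding smooth_on_def by blast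

lemma smooth_on_cong:
  assumes "open S" "\<And>x. x \<in> S \<Longrightarrow> f x = g x"
  shows "smooth_on S f \<longleftrightarrow> smooth_on S g"
  using C_k_on_cong[OF assms] by (simp add: smooth_on_def)

lemma smooth_on_subset: "smooth_on S f \<Longrightarrow> T \<subseteq> S \<Longrightarrow> smooth_on T f"
  unfolding smooth_on_def using C_k_on_subset by blast

lemma smooth_on_local:
  assumes "\<And>x. x \<in> S \<Longrightarrow> \<exists>T. open T \<and> x \<in> T \<and> smooth_on (S \<inter> T) f"
  shows "smooth_on S f"
  unfolding smooth_on_def
proof
  fix k
  show "C_k_on k S f"
  proof (rule C_k_on_local)
    fix x assume "x \<in> S"
    then obtain T where "open T" "x \<in> T" "smooth_on (S \<inter> T) f" using assms by blast
    then show "\<exists>T. open T \<and> x \<in> T \<and> C_k_on k (S \<inter> T) f" using smooth_on_D by blast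
  qed
qed

lemma smooth_on_Pair:
  "open S \<Longrightarrow> smooth_on S f \<Longrightarrow> smooth_on S g \<Longrightarrow> smooth_on S (\<lambda>x. (f x, g x))"
  by (simp add: smooth_on_def C_k_on_Pair)

lemma smooth_on_bounded_linear:
  "open S \<Longrightarrow> bounded_linear T \<Longrightarrow> smooth_on S f \<Longrightarrow> smooth_on S (\<lambda>x. T (f x))"
  by (simp add: smooth_on_def C_k_on_bounded_linear)

lemma smooth_on_const: "open S \<Longrightarrow> smooth_on S (\<lambda>x. c)"
  by (simp add: smooth_on_def C_k_on_const)

lemma smooth_on_id: "open S \<Longrightarrow> smooth_on S (\<lambda>x. x)"
  by (simp add: smooth_on_def C_k_on_id)

lemma smooth_on_frechet_derivative:
  "smooth_on S f \<Longrightarrow> smooth_on S (\<lambda>x. frechet_derivative f (at x) v)"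
  unfolding smooth_on_def by (metis C_k_on.simps(2))

lemma smooth_on_has_derivative:
  "smooth_on S f \<Longrightarrow> x \<in> S \<Longrightarrow> (f has_derivative frechet_derivative f (at x)) (at x)"
  unfolding smooth_on_def using C_k_on_SucE by blast

lemma smooth_on_continuous_on: "smooth_on S f \<Longrightarrow> continuous_on S f"
  unfolding smooth_on_def by (metis C_k_on.simps(1))

text \<open>What the middle manifold of a composition has to provide; the product atlas
  satisfies it too.\<close>

definition chart_cover :: "('x::topological_space, 'd::euclidean_space) atlas \<Rightarrow> bool" where
  "chart_cover \<A> \<longleftrightarrow> (\<Union>(U, \<phi>)\<in>\<A>. U) = UNIV \<and>
     (\<forall>(U, \<phi>)\<in>\<A>. open U \<and> open (\<phi> ` U) \<and> homeomorphism U (\<phi> ` U) \<phi> (inv_into U \<phi>))"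

lemma smooth_atlas_chart_cover: "smooth_atlas \<A> \<Longrightarrow> chart_cover \<A>"
  by (auto simp: smooth_atlas_def chart_cover_def)

lemma chart_coverD:
  assumes "chart_cover \<A>" "(U, \<phi>) \<in> \<A>"
  shows "open U" "open (\<phi> ` U)" "continuous_on U \<phi>" "continuous_on (\<phi> ` U) (inv_into U \<phi>)"
    "inj_on \<phi> U"
proof -
  have h: "homeomorphism U (\<phi> ` U) \<phi> (inv_into U \<phi>)" and o: "open U" "open (\<phi> ` U)"
    using assms by (auto simp: chart_cover_def)
  show "open U" "open (\<phi> ` U)" by (fact o)+
  show "continuous_on U \<phi>" "continuous_on (\<phi> ` U) (inv_into U \<phi>)"
    using h by (auto simp: homeomorphism_def)
  show "inj_on \<phi> U" using h by (metis homeomorphism_apply1 inj_onI)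
qed

lemma chart_cover_obtain:
  assumes "chart_cover \<A>"
  obtains U \<phi> where "(U, \<phi>) \<in> \<A>" "x \<in> U"
  using assms by (fastforce simp: chart_cover_def)

lemma open_chart_image:
  assumes "chart_cover \<A>" "(U, \<phi>) \<in> \<A>" "open W"
  shows "open (\<phi> ` (U \<inter> W))"
proof -
  note c = chart_coverD[OF assms(1,2)]
  have "\<phi> ` (U \<inter> W) = \<phi> ` U \<inter> inv_into U \<phi> -` W"
    using c(5) by (auto simp: inv_into_f_f)
  also have "open \<dots>"
    using continuous_open_preimage[OF c(4,2) assms(3)] .
  finally show ?thesis .
qed

lemma chart_cover_standard: "chart_cover standard_atlas"
  by (auto simp: chart_cover_def standard_atlas_def homeomorphism_def)

lemma homeomorphism_map_prod:
  assumes "homeomorphism U U' f f'" "homeomorphism V V' g g'"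
  shows "homeomorphism (U \<times> V) (U' \<times> V') (map_prod f g) (map_prod f' g')"
proof (rule homeomorphismI)
  have c: "continuous_on U f" "continuous_on V g" "continuous_on U' f'" "continuous_on V' g'"
    using assms by (auto simp: homeomorphism_def)
  show "continuous_on (U \<times> V) (map_prod f g)" "continuous_on (U' \<times> V') (map_prod f' g')"
    unfolding map_prod_def case_prod_unfold
    by (intro continuous_on_Pair continuous_on_compose2[OF c(1)] continuous_on_compose2[OF c(2)]
        continuous_on_compose2[OF c(3)] continuous_on_compose2[OF c(4)] continuous_on_fst
        continuous_on_snd continuous_on_id; auto)+
qed (use assms in \<open>auto simp: homeomorphism_def\<close>)

lemma chart_cover_product:
  assumes "chart_cover \<A>" "chart_cover \<B>"
  shows "chart_cover (product_atlas \<A> \<B>)"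
proof -
  have "(a, b) \<in> (\<Union>(U, \<phi>)\<in>product_atlas \<A> \<B>. U)" for a b
  proof -
    obtain U \<phi> where "(U, \<phi>) \<in> \<A>" "a \<in> U" by (rule chart_cover_obtain[OF assms(1)])
    moreover obtain V \<psi> where "(V, \<psi>) \<in> \<B>" "b \<in> V" by (rule chart_cover_obtain[OF assms(2)])
    ultimately have "(U \<times> V, map_prod \<phi> \<psi>) \<in> product_atlas \<A> \<B>" "(a, b) \<in> U \<times> V"
      by (auto simp: product_atlas_def)
    then show ?thesis by blast
  qed
  then have "(\<Union>(U, \<phi>)\<in>product_atlas \<A> \<B>. U) = UNIV" by auto
  moreover have "open W \<and> open (\<xi> ` W) \<and> homeomorphism W (\<xi> ` W) \<xi> (inv_into W \<xi>)"
    if W\<xi>: "(W, \<xi>) \<in> product_atlas \<A> \<B>" for W \<xi>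
  proof -
    obtain U \<phi> V \<psi> where *: "W = U \<times> V" "\<xi> = map_prod \<phi> \<psi>" "(U, \<phi>) \<in> \<A>" "(V, \<psi>) \<in> \<B>"
      using W\<xi> unfolding product_atlas_def by blast
    note a = chart_coverD[OF assms(1) *(3)] and b = chart_coverD[OF assms(2) *(4)]
    have im: "\<xi> ` W = \<phi> ` U \<times> \<psi> ` V" by (auto simp: * image_def)
    have inj: "inj_on \<xi> W" using a(5) b(5) by (auto simp: * inj_on_def)
    have "homeomorphism U (\<phi> ` U) \<phi> (inv_into U \<phi>)" "homeomorphism V (\<psi> ` V) \<psi> (inv_into V \<psi>)"
      using assms * by (auto simp: chart_cover_def)
    then have h: "homeomorphism W (\<xi> ` W) \<xi> (map_prod (inv_into U \<phi>) (inv_into V \<psi>))"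
      unfolding im unfolding * by (rule homeomorphism_map_prod)
    \<comment> \<open>\<open>chart_cover\<close> insists on \<open>inv_into\<close>, which agrees
      with the product of the two inverses on the image of the chart.\<close>
    have "homeomorphism W (\<xi> ` W) \<xi> (inv_into W \<xi>)"
      by (rule homeomorphism_cong[OF h]) (use h inj in \<open>auto simp: homeomorphism_def inv_into_f_f\<close>)
    then show ?thesis using a b im by (auto simp: * intro!: open_Times)
  qed
  ultimately show ?thesis by (auto simp: chart_cover_def)
qed

lemma smooth_mapD:
  assumes "smooth_map \<A> \<B> F" "(U, \<phi>) \<in> \<A>" "(V, \<psi>) \<in> \<B>"
  shows "smooth_on (\<phi> ` (U \<inter> F -` V)) (\<lambda>x. \<psi> (F (inv_into U \<phi> x)))"
  using assms by (auto simp: smooth_map_def comp_def split: prod.splits)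

lemma smooth_map_continuous: "smooth_map \<A> \<B> F \<Longrightarrow> continuous_on UNIV F"
  by (simp add: smooth_map_def)

text \<open>Smoothness is checked near each point, through a chart of \<open>\<B>\<close> around the
  image point. As \<open>smooth_map\<close> quantifies over all pairs of charts, any such chart will
  do.\<close>

lemma smooth_map_compose:
  assumes A: "chart_cover \<A>" and B: "chart_cover \<B>" and C: "chart_cover \<C>"
    and F: "smooth_map \<A> \<B> F" and G: "smooth_map \<B> \<C> G"
  shows "smooth_map \<A> \<C> (\<lambda>x. G (F x))"
proof -
  have cF: "continuous_on UNIV F" and cG: "continuous_on UNIV G"
    using F G by (auto simp: smooth_map_def)
  then have cGF: "continuous_on UNIV (\<lambda>x. G (F x))" by (metis continuous_on_compose2 subset_UNIV)
  have "smooth_on (\<phi> ` (U \<inter> (\<lambda>x. G (F x)) -` W)) (\<lambda>x. \<xi> (G (F (inv_into U \<phi> x))))"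
    if U: "(U, \<phi>) \<in> \<A>" and W: "(W, \<xi>) \<in> \<C>" for U \<phi> W \<xi>
  proof (rule smooth_on_local)
    fix p assume p: "p \<in> \<phi> ` (U \<inter> (\<lambda>x. G (F x)) -` W)"
    then obtain x where x: "p = \<phi> x" "x \<in> U" "G (F x) \<in> W" by auto
    note cU = chart_coverD[OF A U] and cW = chart_coverD[OF C W]
    obtain V \<psi> where V: "(V, \<psi>) \<in> \<B>" "F x \<in> V" by (rule chart_cover_obtain[OF B])
    note cV = chart_coverD[OF B V(1)]
    have o1: "open (F -` V)" and o2: "open (G -` W)" and o3: "open ((\<lambda>x. G (F x)) -` W)"
      using cF cG cGF cV(1) cW(1) by (auto intro: open_vimage)
    \<comment> \<open>On this part of the chart \<open>F\<close> stays inside the single chart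
      domain \<open>V\<close>, so the coordinate map of \<open>V\<close> and its inverse cancel
      between the two representations.\<close>
    let ?T = "\<phi> ` (U \<inter> (F -` V \<inter> (\<lambda>x. G (F x)) -` W))"
    have T: "open ?T" using o1 o3 by (intro open_chart_image[OF A U]) auto
    have "smooth_on ?T (\<lambda>x. \<psi> (F (inv_into U \<phi> x)))"
      by (rule smooth_on_subset[OF smooth_mapD[OF F U V(1)]]) auto
    moreover have "smooth_on (\<psi> ` (V \<inter> G -` W)) (\<lambda>x. \<xi> (G (inv_into V \<psi> x)))"
      by (rule smooth_mapD[OF G V(1) W])
    ultimately have "smooth_on ?T (\<lambda>x. \<xi> (G (inv_into V \<psi> (\<psi> (F (inv_into U \<phi> x))))))"
      using cU(5) smooth_on_compose[OF T open_chart_image[OF B V(1) o2], of "\<lambda>x. \<psi> (F (inv_into U \<phi> x))"]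
      by (force simp: inv_into_f_f)
    then have "smooth_on ?T (\<lambda>x. \<xi> (G (F (inv_into U \<phi> x))))"
      using cU(5) cV(5) by (subst (asm) smooth_on_cong[OF T]) (auto simp: inv_into_f_f)
    moreover have "p \<in> ?T" using x V by auto
    ultimately show "\<exists>T. open T \<and> p \<in> T \<and> smooth_on (\<phi> ` (U \<inter> (\<lambda>x. G (F x)) -` W) \<inter> T)
        (\<lambda>x. \<xi> (G (F (inv_into U \<phi> x))))"
      using T by (intro exI[of _ ?T]) (auto intro: smooth_on_subset)
  qed
  then show ?thesis using cGF by (auto simp: smooth_map_def comp_def)
qed

lemma smooth_map_Pair:
  assumes A: "chart_cover \<A>" and B: "chart_cover \<B>" and C: "chart_cover \<C>"
    and F: "smooth_map \<A> \<B> F" and G: "smooth_map \<A> \<C> G"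
  shows "smooth_map \<A> (product_atlas \<B> \<C>) (\<lambda>x. (F x, G x))"
proof -
  have cF: "continuous_on UNIV F" and cG: "continuous_on UNIV G"
    using F G by (auto simp: smooth_map_def)
  have "smooth_on (\<phi> ` (U \<inter> (\<lambda>x. (F x, G x)) -` (V \<times> W)))
      (\<lambda>x. map_prod \<psi> \<xi> (F (inv_into U \<phi> x), G (inv_into U \<phi> x)))"
    if U: "(U, \<phi>) \<in> \<A>" and V: "(V, \<psi>) \<in> \<B>" and W: "(W, \<xi>) \<in> \<C>" for U \<phi> V \<psi> W \<xi>
  proof -
    have eq: "(\<lambda>x. (F x, G x)) -` (V \<times> W) = F -` V \<inter> G -` W" by auto
    have "open (\<phi> ` (U \<inter> (F -` V \<inter> G -` W)))"
      using cF cG chart_coverD(1)[OF B V] chart_coverD(1)[OF C W]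
      by (intro open_chart_image[OF A U]) (auto intro!: open_vimage)
    then show ?thesis
      unfolding eq map_prod_simp
      by (rule smooth_on_Pair) (auto intro: smooth_on_subset[OF smooth_mapD[OF F U V]]
          smooth_on_subset[OF smooth_mapD[OF G U W]])
  qed
  then show ?thesis using cF cG
    by (auto simp: smooth_map_def comp_def product_atlas_def intro!: continuous_intros)
qed

lemma smooth_map_standard_iff:
  "smooth_map standard_atlas standard_atlas F \<longleftrightarrow> smooth_on UNIV F"
  by (auto simp: smooth_map_def standard_atlas_def comp_def intro: smooth_on_continuous_on)

subsection \<open>Lie groups in exponential coordinates\<close>

text \<open>A Gronwall argument: the squared norm of the difference, damped by
  \<open>exp (- (2 * K * t))\<close> with \<open>K\<close> the operator norm of \<open>T\<close>, is
  nonincreasing and starts at 0.\<close>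

lemma linear_ode_unique:
  fixes k l :: "real \<Rightarrow> 'a::real_inner"
  assumes T: "bounded_linear T"
    and k: "\<And>t. (k has_vector_derivative w - T (k t)) (at t)"
    and l: "\<And>t. (l has_vector_derivative w - T (l t)) (at t)"
    and 0: "k 0 = l 0"
  shows "k 1 = l 1"
proof -
  define e where "e t = k t - l t" for t
  define K where "K = onorm T"
  define \<phi> where "\<phi> t = (e t \<bullet> e t) * exp (- (2 * K * t))" for t
  have e': "(e has_vector_derivative - T (e t)) (at t)" for t
    unfolding e_def
    by (rule has_vector_derivative_eq_rhs[OF has_vector_derivative_diff[OF k l]])
       (simp add: linear_diff[OF bounded_linear.linear[OF T]])
  have d: "(\<phi> has_real_derivative
      (2 * (- T (e t) \<bullet> e t) - 2 * K * (e t \<bullet> e t)) * exp (- (2 * K * t))) (at t)" for t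
  proof -
    have "((\<lambda>t. e t \<bullet> e t) has_real_derivative 2 * (- T (e t) \<bullet> e t)) (at t)"
    proof -
      have "((\<lambda>t. e t \<bullet> e t) has_derivative (\<lambda>h. e t \<bullet> (h *\<^sub>R - T (e t)) + (h *\<^sub>R - T (e t)) \<bullet> e t)) (at t)"
        by (intro has_derivative_inner e'[unfolded has_vector_derivative_def])
      moreover have "(\<lambda>h. e t \<bullet> (h *\<^sub>R - T (e t)) + (h *\<^sub>R - T (e t)) \<bullet> e t) = (*) (2 * (- T (e t) \<bullet> e t))"
        by (auto simp: fun_eq_iff inner_commute)
      ultimately show ?thesis by (simp add: has_field_derivative_def)
    qed
    then show ?thesis
      unfolding \<phi>_def by (auto intro!: derivative_eq_intros simp: algebra_simps)
  qed
  have "\<phi> 1 \<le> \<phi> 0"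
  proof (rule DERIV_nonpos_imp_nonincreasing[of 0 1 \<phi>])
    fix t :: real
    have "- T (e t) \<bullet> e t \<le> norm (T (e t)) * norm (e t)"
      using norm_cauchy_schwarz[of "- T (e t)" "e t"] by simp
    also have "\<dots> \<le> (K * norm (e t)) * norm (e t)"
      unfolding K_def by (intro mult_right_mono onorm[OF T]) auto
    also have "\<dots> = K * (e t \<bullet> e t)" by (simp add: dot_square_norm power2_eq_square)
    finally have "(2 * (- T (e t) \<bullet> e t) - 2 * K * (e t \<bullet> e t)) * exp (- (2 * K * t)) \<le> 0"
      by (intro mult_nonpos_nonneg) auto
    then show "\<exists>y. (\<phi> has_real_derivative y) (at t) \<and> y \<le> 0" using d by blast
  qed simp
  then have "e 1 \<bullet> e 1 \<le> 0"
    using 0 by (simp add: \<phi>_def e_def mult_le_0_iff not_le[symmetric])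
  then have "e 1 = 0" by (metis inner_gt_zero_iff not_le)
  then show ?thesis by (simp add: e_def)
qed

text \<open>A Lie group in exponential coordinates: \<open>P x v\<close> is the value at \<open>x\<close> of the
  left-invariant vector field with label \<open>v\<close>.\<close>

locale exponential_coordinates =
  fixes m :: "'v::euclidean_space \<Rightarrow> 'v \<Rightarrow> 'v" and P :: "'v \<Rightarrow> 'v \<Rightarrow> 'v"
  assumes smooth: "smooth_on UNIV (\<lambda>z. m (fst z) (snd z))"
    and assoc: "m (m x y) z = m x (m y z)"
    and left_zero: "m 0 x = x"
    and right_zero: "m x 0 = x"
    and one_parameter: "m (s *\<^sub>R x) (t *\<^sub>R x) = (s + t) *\<^sub>R x"
    and P_eq: "P x v = frechet_derivative (m x) (at 0) v"
begin

text \<open>The differential of the left translation \<open>m x\<close> at \<open>y\<close>, written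
  as a partial derivative of the joint map so that smoothness in both points is inherited.\<close>

definition D :: "'v \<Rightarrow> 'v \<Rightarrow> 'v \<Rightarrow> 'v" where
  "D x y w = frechet_derivative (\<lambda>z. m (fst z) (snd z)) (at (x, y)) (0, w)"

definition dP :: "'v \<Rightarrow> 'v \<Rightarrow> 'v \<Rightarrow> 'v" where
  "dP x v u = frechet_derivative (\<lambda>x. P x v) (at x) u"

text \<open>The inverse of \<open>P x\<close>, obtained as the differential at \<open>x\<close> of
  the translation that carries \<open>x\<close> to 0. In this form smoothness in \<open>x\<close> is
  immediate.\<close>

definition J :: "'v \<Rightarrow> 'v \<Rightarrow> 'v" where
  "J x w = D (- x) x w"

lemma left_inverse: "m (- x) x = 0"
  using one_parameter[of "-1" x 1] by simp

lemma right_inverse: "m x (- x) = 0"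
  using one_parameter[of 1 x "-1"] by simp

lemma has_derivative_m: "(m x has_derivative D x y) (at y)"
proof -
  have 1: "((\<lambda>y. (x, y)) has_derivative (\<lambda>w. (0, w))) (at y)"
    by (auto intro!: derivative_eq_intros)
  have "((\<lambda>z. m (fst z) (snd z)) has_derivative
      frechet_derivative (\<lambda>z. m (fst z) (snd z)) (at (x, y))) (at (x, y))"
    using smooth_on_has_derivative[OF smooth] by simp
  from has_derivative_compose[OF 1 this] show ?thesis unfolding D_def by simp
qed

lemma P_eq_D: "P x v = D x 0 v"
  by (simp add: P_eq frechet_derivative_at[OF has_derivative_m, symmetric])

lemma linear_D: "linear (D x y)"
  using has_derivative_m has_derivative_linear by blast

lemma linear_P: "linear (P x)"
  using linear_D[of x 0] by (simp add: P_eq_D[abs_def])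

lemma smooth_D: "smooth_on UNIV (\<lambda>z. D (fst z) (snd z) w)"
  using smooth_on_frechet_derivative[OF smooth, of "(0, w)"] by (simp add: D_def)

lemma smooth_P: "smooth_on UNIV (\<lambda>x. P x v)"
  using smooth_on_compose[OF open_UNIV open_UNIV _
      smooth_on_Pair[OF open_UNIV smooth_on_id[OF open_UNIV] smooth_on_const[OF open_UNIV, of 0]]
      smooth_D[of v]]
  by (simp add: P_eq_D)

lemma smooth_J: "smooth_on UNIV (\<lambda>x. J x v)"
  using smooth_on_compose[OF open_UNIV open_UNIV _
      smooth_on_Pair[OF open_UNIV smooth_on_bounded_linear[OF open_UNIV
         bounded_linear_minus[OF bounded_linear_ident] smooth_on_id[OF open_UNIV]]
        smooth_on_id[OF open_UNIV]] smooth_D[of v]]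
  by (simp add: J_def)

lemma has_derivative_P: "((\<lambda>x. P x v) has_derivative dP x v) (at x)"
  unfolding dP_def[abs_def] using smooth_on_has_derivative[OF smooth_P] by simp

text \<open>The chain rule at \<open>z = 0\<close> for the associative law
  \<open>m x (m y z) = m (m x y) z\<close>: translations preserve the left-invariant fields.\<close>

lemma D_P: "D x y (P y v) = P (m x y) v"
proof -
  have "(m y has_derivative D y 0) (at 0)" by (rule has_derivative_m)
  moreover have "(m x has_derivative D x y) (at (m y 0))"
    using has_derivative_m by (simp add: right_zero)
  ultimately have "((\<lambda>z. m x (m y z)) has_derivative (\<lambda>w. D x y (D y 0 w))) (at 0)"
    by (rule has_derivative_compose)
  moreover have "((\<lambda>z. m x (m y z)) has_derivative D (m x y) 0) (at 0)"
    using has_derivative_m[of "m x y" 0] by (simp add: assoc[symmetric])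
  ultimately have "(\<lambda>w. D x y (D y 0 w)) = D (m x y) 0"
    by (rule has_derivative_unique)
  then show ?thesis by (simp add: P_eq_D fun_eq_iff)
qed

lemma P_zero: "P 0 v = v"
proof -
  have "m 0 = (\<lambda>x. x)" using left_zero by auto
  then have "D 0 0 = (\<lambda>x. x)"
    using has_derivative_m[of 0 0] has_derivative_unique[OF _ has_derivative_ident] by metis
  then show ?thesis by (simp add: P_eq_D)
qed

text \<open>Rays are one-parameter subgroups, so translating the ray through \<open>x\<close> along
  itself gives a curve with constant velocity \<open>x\<close>.\<close>

lemma P_line: "P (t *\<^sub>R x) x = x"
proof -
  have "((\<lambda>s. s *\<^sub>R x) has_derivative (\<lambda>s. s *\<^sub>R x)) (at 0)"
    by (auto intro!: derivative_eq_intros)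
  moreover have "(m (t *\<^sub>R x) has_derivative D (t *\<^sub>R x) 0) (at (0 *\<^sub>R x))"
    using has_derivative_m[of "t *\<^sub>R x" 0] by simp
  ultimately have "((\<lambda>s. m (t *\<^sub>R x) (s *\<^sub>R x)) has_derivative (\<lambda>s. D (t *\<^sub>R x) 0 (s *\<^sub>R x))) (at 0)"
    by (rule has_derivative_compose)
  moreover have "((\<lambda>s. m (t *\<^sub>R x) (s *\<^sub>R x)) has_derivative (\<lambda>s. s *\<^sub>R x)) (at 0)"
    unfolding one_parameter by (auto intro!: derivative_eq_intros)
  ultimately have "(\<lambda>s. D (t *\<^sub>R x) 0 (s *\<^sub>R x)) = (\<lambda>s. s *\<^sub>R x)"
    by (rule has_derivative_unique)
  from fun_cong[OF this, of 1] show ?thesis by (simp add: P_eq_D)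
qed

lemma J_P: "J x (P x v) = v"
  using D_P[of "- x" x v] by (simp add: J_def left_inverse P_zero)

lemma P_J: "P x (J x w) = w"
proof -
  have "(m x has_derivative D x 0) (at (m (- x) x))"
    using has_derivative_m by (simp add: left_inverse)
  with has_derivative_m[of "- x" x]
  have "((\<lambda>y. m x (m (- x) y)) has_derivative (\<lambda>w. D x 0 (D (- x) x w))) (at x)"
    by (rule has_derivative_compose)
  moreover have "((\<lambda>y. m x (m (- x) y)) has_derivative (\<lambda>w. w)) (at x)"
    by (simp add: assoc[symmetric] right_inverse left_zero)
  ultimately have "(\<lambda>w. D x 0 (D (- x) x w)) = (\<lambda>w. w)"
    by (rule has_derivative_unique)
  then show ?thesis by (simp add: P_eq_D J_def fun_eq_iff)
qed

lemma P_sum: "P x v = (\<Sum>b\<in>Basis. (v \<bullet> b) *\<^sub>R P x b)"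
  by (subst euclidean_representation[symmetric, of v])
     (simp only: linear_sum[OF linear_P] linear_cmul[OF linear_P])

lemma dP_sum: "dP x v u = (\<Sum>b\<in>Basis. (v \<bullet> b) *\<^sub>R dP x b u)"
proof -
  have "((\<lambda>x. \<Sum>b\<in>Basis. (v \<bullet> b) *\<^sub>R P x b) has_derivative
      (\<lambda>u. \<Sum>b\<in>Basis. (v \<bullet> b) *\<^sub>R dP x b u)) (at x)"
    by (intro has_derivative_sum has_derivative_scaleR_right has_derivative_P)
  then have "((\<lambda>x. P x v) has_derivative (\<lambda>u. \<Sum>b\<in>Basis. (v \<bullet> b) *\<^sub>R dP x b u)) (at x)"
    by (subst P_sum)
  then show ?thesis using has_derivative_unique[OF has_derivative_P] by metis
qed

lemma linear_dP_right: "linear (dP x v)"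
  using has_derivative_P has_derivative_linear by blast

lemma linear_dP_left: "linear (\<lambda>v. dP x v u)"
  by (subst dP_sum) (auto intro!: linearI simp: algebra_simps sum.distrib scaleR_sum_right)

text \<open>Differentiability of \<open>P\<close> is available for fixed labels only; expanding the
  moving label in \<open>Basis\<close> reduces the rule to ordinary products.\<close>

lemma has_derivative_P_comp:
  assumes h: "(h has_derivative h') (at t)" and g: "(g has_derivative g') (at t)"
  shows "((\<lambda>t. P (h t) (g t)) has_derivative (\<lambda>s. P (h t) (g' s) + dP (h t) (g t) (h' s))) (at t)"
proof -
  have "((\<lambda>t. \<Sum>b\<in>Basis. (g t \<bullet> b) *\<^sub>R P (h t) b) has_derivative
     (\<lambda>s. \<Sum>b\<in>Basis. (g t \<bullet> b) *\<^sub>R dP (h t) b (h' s) + (g' s \<bullet> b) *\<^sub>R P (h t) b)) (at t)"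
    by (intro has_derivative_sum has_derivative_scaleR has_derivative_inner_left g
        has_derivative_compose[OF h has_derivative_P])
  moreover have "(\<Sum>b\<in>Basis. (g t \<bullet> b) *\<^sub>R dP (h t) b (h' s) + (g' s \<bullet> b) *\<^sub>R P (h t) b) =
      P (h t) (g' s) + dP (h t) (g t) (h' s)" for s
    by (subst (2) P_sum, subst (2) dP_sum) (simp add: sum.distrib)
  ultimately show ?thesis by (subst P_sum) simp
qed

lemma dP_self: "dP y y w = w - P y w"
proof -
  have "((\<lambda>y. P y y) has_derivative (\<lambda>s. P y s + dP y y s)) (at y)"
    by (intro has_derivative_P_comp has_derivative_ident)
  moreover have "(\<lambda>y. P y y) = (\<lambda>y. y)" using P_line[of 1] by simp
  ultimately have "(\<lambda>s. P y s + dP y y s) = (\<lambda>s. s)"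
    using has_derivative_unique[OF _ has_derivative_ident] by metis
  then show ?thesis by (metis add_diff_cancel_left')
qed

end

text \<open>The commutator of two vector fields in coordinates is the derivative of the second along
  the first minus the reverse; \<open>br u v\<close> is the label of this commutator.\<close>

locale exponential_coordinates_bracket = exponential_coordinates +
  fixes br :: "'a \<Rightarrow> 'a \<Rightarrow> 'a"
  assumes bracket: "P x (br u v) = dP x v (P x u) - dP x u (P x v)"
begin

text \<open>At the unit \<open>P\<close> is the identity, so there the axiom \<open>bracket\<close>
  expresses \<open>br\<close> through derivatives of \<open>P\<close>, which are linear in label and
  direction.\<close>

lemma bounded_linear_br: "bounded_linear (br x)"
proof -
  have "br x = (\<lambda>v. dP 0 v x - dP 0 x v)"
    using bracket[of 0 x] by (simp add: P_zero fun_eq_iff)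
  moreover have "linear (\<lambda>v. dP 0 v x - dP 0 x v)"
    by (intro linear_compose_sub linear_dP_left linear_dP_right)
  ultimately show ?thesis by (simp add: linear_conv_bounded_linear)
qed

text \<open>\<open>J\<close> is the left-trivialised differential of the exponential map; the equation below
  integrates to \<open>J x = (1 - exp (- ad x)) / ad x\<close>.\<close>

lemma J_ode:
  "((\<lambda>t. t *\<^sub>R J (t *\<^sub>R x) w) has_vector_derivative w - br x (t *\<^sub>R J (t *\<^sub>R x) w)) (at t)"
proof -
  define k where "k t = t *\<^sub>R J (t *\<^sub>R x) w" for t
  have lin: "((\<lambda>t. t *\<^sub>R x) has_derivative (\<lambda>s. s *\<^sub>R x)) (at t)" for t
    by (auto intro!: derivative_eq_intros)
  have "((\<lambda>x. J x w) has_derivative frechet_derivative (\<lambda>x. J x w) (at (t *\<^sub>R x))) (at (t *\<^sub>R x))"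
    using smooth_on_has_derivative[OF smooth_J] by simp
  from has_derivative_scaleR[OF has_derivative_ident has_derivative_compose[OF lin this]]
  have "k differentiable (at t)"
    unfolding k_def differentiable_def by blast
  then obtain k' where k': "(k has_vector_derivative k') (at t)"
    using vector_derivative_works by blast
  \<comment> \<open>The right side is linear in \<open>t\<close>, so differentiating this identity
    gives an equation for the derivative of \<open>k\<close>.\<close>
  have Pk: "P (t *\<^sub>R x) (k t) = t *\<^sub>R w" for t
    by (simp add: k_def linear_cmul[OF linear_P] P_J)
  have "((\<lambda>t. P (t *\<^sub>R x) (k t)) has_derivative
      (\<lambda>s. P (t *\<^sub>R x) (s *\<^sub>R k') + dP (t *\<^sub>R x) (k t) (s *\<^sub>R x))) (at t)"
    using k' unfolding has_vector_derivative_def by (intro has_derivative_P_comp lin)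
  moreover have "((\<lambda>t. P (t *\<^sub>R x) (k t)) has_derivative (\<lambda>s. s *\<^sub>R w)) (at t)"
    unfolding Pk by (auto intro!: derivative_eq_intros)
  ultimately have "(\<lambda>s. P (t *\<^sub>R x) (s *\<^sub>R k') + dP (t *\<^sub>R x) (k t) (s *\<^sub>R x)) = (\<lambda>s. s *\<^sub>R w)"
    by (rule has_derivative_unique)
  from fun_cong[OF this, of 1]
  have 1: "P (t *\<^sub>R x) k' + dP (t *\<^sub>R x) (k t) x = w" by simp
  have "P (t *\<^sub>R x) (br x (k t)) = dP (t *\<^sub>R x) (k t) x - dP (t *\<^sub>R x) x (t *\<^sub>R w)"
    using bracket[of "t *\<^sub>R x" x "k t"] by (simp add: P_line Pk)
  \<comment> \<open>Bilinearity moves the factor \<open>t\<close> from the direction to the label,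
    which then equals the base point, the situation of \<open>dP_self\<close>.\<close>
  moreover have "dP (t *\<^sub>R x) x (t *\<^sub>R w) = w - P (t *\<^sub>R x) w"
    using dP_self[of "t *\<^sub>R x" w]
    by (simp add: linear_cmul[OF linear_dP_left] linear_cmul[OF linear_dP_right])
  ultimately have "P (t *\<^sub>R x) k' = P (t *\<^sub>R x) (w - br x (k t))"
    using eq_diff_eq[THEN iffD2, OF 1] by (simp add: linear_diff[OF linear_P])
  then have "k' = w - br x (k t)" by (metis J_P)
  with k' show ?thesis by (simp add: k_def[abs_def])
qed

text \<open>The image under \<delta> of the solution belonging to \<open>x\<close> and
  \<open>w\<close> solves the equation belonging to \<open>\<delta> x\<close> and
  \<open>\<delta> w\<close>, since \<delta> respects \<open>br\<close>. Both start at 0, so they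
  agree at time 1, which says that \<open>J\<close> and hence \<open>P\<close> commute with
  \<delta>.\<close>

lemma P_equivariant:
  assumes \<delta>: "linear \<delta>" and br: "\<And>u v. \<delta> (br u v) = br (\<delta> u) (\<delta> v)"
  shows "P (\<delta> x) (\<delta> v) = \<delta> (P x v)"
proof -
  define w where "w = P x v"
  define k where "k t = \<delta> (t *\<^sub>R J (t *\<^sub>R x) w)" for t :: real
  define l where "l t = t *\<^sub>R J (t *\<^sub>R \<delta> x) (\<delta> w)" for t :: real
  have "k 1 = l 1"
  proof (rule linear_ode_unique)
    show "bounded_linear (br (\<delta> x))" by (rule bounded_linear_br)
    show "(k has_vector_derivative \<delta> w - br (\<delta> x) (k t)) (at t)" for t
      using bounded_linear.has_vector_derivative[OF \<delta>[unfolded linear_conv_bounded_linear] J_ode[of x w t]]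
      by (simp add: k_def[abs_def] linear_diff[OF \<delta>] br)
    show "(l has_vector_derivative \<delta> w - br (\<delta> x) (l t)) (at t)" for t
      using J_ode[of "\<delta> x" "\<delta> w" t] by (simp add: l_def[abs_def])
  qed (simp add: k_def l_def linear_0[OF \<delta>])
  then have "\<delta> v = J (\<delta> x) (\<delta> w)" by (simp add: k_def l_def w_def J_P)
  then show ?thesis by (simp add: P_J w_def)
qed

end

section \<open>Smooth functions and left-invariant fields on a manifold\<close>

lemma standard_atlas_product: "product_atlas standard_atlas standard_atlas = standard_atlas"
  by (auto simp: product_atlas_def standard_atlas_def)

lemma smooth_map_const:
  assumes "chart_cover \<A>"
  shows "smooth_map \<A> \<B> (\<lambda>x. c)"
  using chart_coverD(2)[OF assms]
  by (auto simp: smooth_map_def comp_def vimage_def intro!: smooth_on_const)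

lemma smooth_map_id:
  assumes "smooth_atlas \<A>"
  shows "smooth_map \<A> \<A> (\<lambda>x. x)"
  using assms by (auto simp: smooth_atlas_def smooth_map_def comp_def)

lemma smooth_map_comp_smooth_on:
  assumes "chart_cover \<A>" "smooth_map \<A> standard_atlas f" "smooth_on UNIV g"
  shows "smooth_map \<A> standard_atlas (\<lambda>x. g (f x))"
  using smooth_map_compose[OF assms(1) chart_cover_standard chart_cover_standard assms(2)] assms(3)
  by (simp add: smooth_map_standard_iff)

lemma smooth_fun_bilinear:
  fixes B :: "'a::euclidean_space \<Rightarrow> 'b::euclidean_space \<Rightarrow> 'c::euclidean_space"
  assumes "chart_cover \<A>" "smooth_fun \<A> f" "smooth_fun \<A> g" "bounded_bilinear B"
  shows "smooth_fun \<A> (\<lambda>x. B (f x) (g x))"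
proof -
  have "smooth_map \<A> standard_atlas (\<lambda>x. (f x, g x))"
    using smooth_map_Pair[OF assms(1) chart_cover_standard chart_cover_standard assms(2,3)]
    by (simp add: standard_atlas_product)
  moreover have "smooth_on UNIV (\<lambda>z. B (fst z) (snd z))"
    unfolding smooth_on_def
    by (intro allI C_k_on_bilinear[OF _ assms(4)] C_k_on_bounded_linear[OF _ bounded_linear_fst]
        C_k_on_bounded_linear[OF _ bounded_linear_snd] C_k_on_id open_UNIV)
  ultimately show ?thesis using smooth_map_comp_smooth_on[OF assms(1)] by fastforce
qed

lemma smooth_fun_linear_combination:
  fixes f g :: "_ \<Rightarrow> real"
  assumes "chart_cover \<A>" "smooth_fun \<A> f" "smooth_fun \<A> g"
  shows "smooth_fun \<A> (\<lambda>x. a * f x + b * g x)"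
proof -
  have "smooth_map \<A> standard_atlas (\<lambda>x. (f x, g x))"
    using smooth_map_Pair[OF assms(1) chart_cover_standard chart_cover_standard assms(2,3)]
    by (simp add: standard_atlas_product)
  moreover have "smooth_on UNIV (\<lambda>z::real \<times> real. a * fst z + b * snd z)"
    by (intro smooth_on_bounded_linear[OF open_UNIV _ smooth_on_id] open_UNIV
        bounded_linear_add bounded_linear_mult_right[THEN bounded_linear_compose]
        bounded_linear_fst bounded_linear_snd)
  ultimately show ?thesis using smooth_map_comp_smooth_on[OF assms(1)] by fastforce
qed

text \<open>In the Leibniz rule the mixed terms \<open>X f * Y g\<close> and
  \<open>Y f * X g\<close> occur in both orders of composition and cancel.\<close>

lemma left_invariant_field_commutator:
  fixes X Y :: "('g::topological_group_add \<Rightarrow> real) \<Rightarrow> 'g \<Rightarrow> real"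
  assumes A: "chart_cover \<A>" and X: "left_invariant_field \<A> X" and Y: "left_invariant_field \<A> Y"
  shows "left_invariant_field \<A> (\<lambda>f x. X (Y f) x - Y (X f) x)"
proof -
  note X' = X[unfolded left_invariant_field_def] and Y' = Y[unfolded left_invariant_field_def]
  note sX = X'[THEN conjunct1, rule_format] and sY = Y'[THEN conjunct1, rule_format]
  note lX = X'[THEN conjunct2, THEN conjunct1, rule_format]
    and lY = Y'[THEN conjunct2, THEN conjunct1, rule_format]
  note pX = X'[THEN conjunct2, THEN conjunct2, THEN conjunct1, rule_format]
    and pY = Y'[THEN conjunct2, THEN conjunct2, THEN conjunct1, rule_format]
  note tX = X'[THEN conjunct2, THEN conjunct2, THEN conjunct2, THEN conjunct1, rule_format]
    and tY = Y'[THEN conjunct2, THEN conjunct2, THEN conjunct2, THEN conjunct1, rule_format]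
  note nX = X'[THEN conjunct2, THEN conjunct2, THEN conjunct2, THEN conjunct2, rule_format]
    and nY = Y'[THEN conjunct2, THEN conjunct2, THEN conjunct2, THEN conjunct2, rule_format]
  have c: "smooth_fun \<A> (\<lambda>_. 0::real)" by (rule smooth_map_const[OF A])
  \<comment> \<open>Serves the last clause of the definition: on a non-smooth function the inner
    field returns the zero function, to which the outer one is then applied.\<close>
  have zX: "X (\<lambda>_. 0) = (\<lambda>_. 0)" and zY: "Y (\<lambda>_. 0) = (\<lambda>_. 0)"
    using lX[OF c c, of 0 0] lY[OF c c, of 0 0] by simp_all
  have pr: "smooth_fun \<A> (\<lambda>x. f x * g x)" if "smooth_fun \<A> f" "smooth_fun \<A> g" for f g :: "_ \<Rightarrow> real"
    using smooth_fun_bilinear[OF A that bounded_bilinear_mult] .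
  have aX: "X (\<lambda>x. f x + g x) = (\<lambda>x. X f x + X g x)"
   and aY: "Y (\<lambda>x. f x + g x) = (\<lambda>x. Y f x + Y g x)"
    if "smooth_fun \<A> f" "smooth_fun \<A> g" for f g
    using lX[OF that, of 1 1] lY[OF that, of 1 1] by simp_all
  show ?thesis
    unfolding left_invariant_field_def
  proof (intro conjI allI impI)
    fix f :: "'g \<Rightarrow> real" assume "smooth_fun \<A> f"
    then show "smooth_fun \<A> (\<lambda>x. X (Y f) x - Y (X f) x)"
      using smooth_fun_linear_combination[OF A sX[OF sY] sY[OF sX], of f f 1 "-1"] by simp
  next
    fix f g :: "'g \<Rightarrow> real" and a b
    assume fg: "smooth_fun \<A> f" "smooth_fun \<A> g"
    show "(\<lambda>x. X (Y (\<lambda>x. a * f x + b * g x)) x - Y (X (\<lambda>x. a * f x + b * g x)) x) =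
        (\<lambda>x. a * (X (Y f) x - Y (X f) x) + b * (X (Y g) x - Y (X g) x))"
      by (simp only: lX[OF fg] lY[OF fg] lX[OF sY[OF fg(1)] sY[OF fg(2)]] lY[OF sX[OF fg(1)] sX[OF fg(2)]])
        (simp add: algebra_simps)
    have "X (Y (\<lambda>x. f x * g x)) =
        (\<lambda>x. (X (Y f) x * g x + Y f x * X g x) + (X f x * Y g x + f x * X (Y g) x))"
      by (simp only: pY[OF fg] aX[OF pr[OF sY[OF fg(1)] fg(2)] pr[OF fg(1) sY[OF fg(2)]]]
          pX[OF sY[OF fg(1)] fg(2)] pX[OF fg(1) sY[OF fg(2)]])
    moreover have "Y (X (\<lambda>x. f x * g x)) =
        (\<lambda>x. (Y (X f) x * g x + X f x * Y g x) + (Y f x * X g x + f x * Y (X g) x))"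
      by (simp only: pX[OF fg] aY[OF pr[OF sX[OF fg(1)] fg(2)] pr[OF fg(1) sX[OF fg(2)]]]
          pY[OF sX[OF fg(1)] fg(2)] pY[OF fg(1) sX[OF fg(2)]])
    ultimately show "(\<lambda>x. X (Y (\<lambda>x. f x * g x)) x - Y (X (\<lambda>x. f x * g x)) x) =
        (\<lambda>x. (X (Y f) x - Y (X f) x) * g x + f x * (X (Y g) x - Y (X g) x))"
      by (simp add: algebra_simps)
  next
    fix f :: "'g \<Rightarrow> real" and z assume f: "smooth_fun \<A> f"
    show "(\<lambda>x. X (Y (\<lambda>x. f (z + x))) x - Y (X (\<lambda>x. f (z + x))) x) =
        (\<lambda>x. X (Y f) (z + x) - Y (X f) (z + x))"
      by (simp only: tX[OF f] tY[OF f] tX[OF sY[OF f]] tY[OF sX[OF f]])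
  next
    fix f :: "'g \<Rightarrow> real" assume "\<not> smooth_fun \<A> f"
    then show "(\<lambda>x. X (Y f) x - Y (X f) x) = (\<lambda>_. 0)" by (simp add: nX nY zX zY)
  qed
qed

section \<open>The homogeneous group in exponential coordinates\<close>

context homogeneous_group
begin

lemma charts: "chart_cover \<A>"
  using atlas by (rule smooth_atlas_chart_cover)

lemma exp_log [simp]: "E (inv E x) = x"
  using exp_bij by (simp add: bij_is_surj surj_f_inv_f)

lemma log_exp [simp]: "inv E (E v) = v"
  using exp_bij by (simp add: bij_is_inj)

lemma exp_add: "E ((s + t) *\<^sub>R v) = E (s *\<^sub>R v) + E (t *\<^sub>R v)"
  using exponential by (simp add: exponential_map_def)

lemma exp_zero [simp]: "E 0 = 0"
  using exp_add[of 0 0 0] by (metis add.right_neutral add_left_cancel scaleR_zero_left)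

lemma log_zero [simp]: "inv E 0 = 0"
  by (metis exp_zero log_exp)

lemma smooth_exp_comp: "smooth_fun \<A> f \<Longrightarrow> smooth_on UNIV (\<lambda>v. f (E v))"
  using smooth_map_compose[OF chart_cover_standard charts chart_cover_standard exp_smooth]
  by (simp add: smooth_map_standard_iff)

lemma smooth_translation:
  fixes f :: "'g \<Rightarrow> 'e::euclidean_space"
  assumes "smooth_fun \<A> f"
  shows "smooth_fun \<A> (\<lambda>x. f (z + x))"
proof -
  have "smooth_map \<A> (product_atlas \<A> \<A>) (\<lambda>x. (z, x))"
    by (intro smooth_map_Pair charts smooth_map_const smooth_map_id atlas)
  from smooth_map_compose[OF charts chart_cover_product[OF charts charts] charts this smooth_mult]
  have "smooth_map \<A> \<A> (\<lambda>x. z + x)" by simp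
  from smooth_map_compose[OF charts charts chart_cover_standard this assms] show ?thesis .
qed

lemma left_invariant_L: "left_invariant_field \<A> (L v)"
  using lie_algebra by (auto simp: lie_algebra_iso_def bij_betw_def)

text \<open>\<open>exponential_map\<close> describes the derivative at the unit only; applying it to
  the left translate of \<open>f\<close> by \<open>x\<close> moves it to \<open>x\<close>.\<close>

lemma L_derivative:
  assumes "smooth_fun \<A> f"
  shows "((\<lambda>t. f (x + E (t *\<^sub>R v))) has_real_derivative L v f x) (at 0)"
proof -
  have "L v (\<lambda>y. f (x + y)) = (\<lambda>y. L v f (x + y))"
    using left_invariant_L assms unfolding left_invariant_field_def by blast
  then have "L v (\<lambda>y. f (x + y)) 0 = L v f x" by simp
  moreover have "((\<lambda>t. f (x + E (t *\<^sub>R v))) has_real_derivative L v (\<lambda>y. f (x + y)) 0) (at 0)"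
  proof -
    have "((\<lambda>t. h (E (t *\<^sub>R v))) has_real_derivative L v h 0) (at 0)" if "smooth_fun \<A> h" for h
      using exponential that by (simp add: exponential_map_def)
    from this[OF smooth_translation[OF assms]] show ?thesis .
  qed
  ultimately show ?thesis by simp
qed

definition prod_coord :: "'v \<Rightarrow> 'v \<Rightarrow> 'v" where
  "prod_coord x y = inv E (E x + E y)"

definition field_coord :: "'v \<Rightarrow> 'v \<Rightarrow> 'v" where
  "field_coord x v = frechet_derivative (prod_coord x) (at 0) v"

lemma exp_prod_coord: "E (prod_coord x y) = E x + E y"
  by (simp add: prod_coord_def)

lemma smooth_prod_coord: "smooth_on UNIV (\<lambda>z. prod_coord (fst z) (snd z))"
proof -
  have std: "smooth_map standard_atlas standard_atlas (fst :: 'v \<times> 'v \<Rightarrow> 'v)"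
    "smooth_map standard_atlas standard_atlas (snd :: 'v \<times> 'v \<Rightarrow> 'v)"
    by (auto simp: smooth_map_standard_iff intro!: smooth_on_bounded_linear[OF _ _ smooth_on_id]
        bounded_linear_fst bounded_linear_snd)
  have "smooth_map standard_atlas (product_atlas \<A> \<A>) (\<lambda>z. (E (fst z), E (snd z)))"
    by (intro smooth_map_Pair charts chart_cover_standard
        smooth_map_compose[OF chart_cover_standard chart_cover_standard charts std(1) exp_smooth]
        smooth_map_compose[OF chart_cover_standard chart_cover_standard charts std(2) exp_smooth])
  from smooth_map_compose[OF chart_cover_standard chart_cover_product[OF charts charts] charts this
      smooth_mult]
  have "smooth_map standard_atlas \<A> (\<lambda>z. E (fst z) + E (snd z))" by simp
  from smooth_map_compose[OF chart_cover_standard charts chart_cover_standard this log_smooth]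
  have "smooth_map standard_atlas standard_atlas (\<lambda>z. inv E (E (fst z) + E (snd z)))" .
  then show ?thesis unfolding smooth_map_standard_iff prod_coord_def .
qed

sublocale exponential_coordinates prod_coord field_coord
proof
  show "prod_coord (s *\<^sub>R x) (t *\<^sub>R x) = (s + t) *\<^sub>R x" for s t x
    by (simp add: prod_coord_def exp_add[symmetric])
qed (simp_all add: smooth_prod_coord, simp_all add: prod_coord_def[abs_def] field_coord_def add.assoc)

lemma smooth_log_component: "smooth_fun \<A> (\<lambda>x. inv E x \<bullet> b)"
  by (intro smooth_map_comp_smooth_on[OF charts log_smooth]
      smooth_on_bounded_linear[OF _ bounded_linear_inner_left smooth_on_id] open_UNIV)

lemma has_derivative_exp_line:
  "((\<lambda>t. prod_coord x (t *\<^sub>R v)) has_derivative (\<lambda>s. s *\<^sub>R field_coord x v)) (at 0)"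
proof -
  have "((\<lambda>s. s *\<^sub>R v) has_derivative (\<lambda>s. s *\<^sub>R v)) (at 0)"
    by (auto intro!: derivative_eq_intros)
  moreover have "(prod_coord x has_derivative D x 0) (at (0 *\<^sub>R v))"
    using has_derivative_m by simp
  ultimately have "((\<lambda>t. prod_coord x (t *\<^sub>R v)) has_derivative (\<lambda>s. D x 0 (s *\<^sub>R v))) (at 0)"
    by (rule has_derivative_compose)
  then show ?thesis by (simp add: P_eq_D linear_cmul[OF linear_D])
qed

lemma L_coord_derivative:
  assumes f: "smooth_fun \<A> f" and F: "((\<lambda>v. f (E v)) has_derivative F') (at x)"
  shows "L v f (E x) = F' (field_coord x v)"
proof -
  have "((\<lambda>t. f (E (prod_coord x (t *\<^sub>R v)))) has_derivative (\<lambda>s. F' (s *\<^sub>R field_coord x v))) (at 0)"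
    using F by (intro has_derivative_compose[OF has_derivative_exp_line]) (simp add: right_zero)
  moreover have "((\<lambda>t. f (E (prod_coord x (t *\<^sub>R v)))) has_derivative (*) (L v f (E x))) (at 0)"
    using L_derivative[OF f, of "E x" v] by (simp add: exp_prod_coord has_field_derivative_def)
  ultimately have "(\<lambda>s. F' (s *\<^sub>R field_coord x v)) = (*) (L v f (E x))"
    by (rule has_derivative_unique)
  from fun_cong[OF this, of 1] show ?thesis by simp
qed

lemma L_log_component: "L v (\<lambda>x. inv E x \<bullet> b) (E x) = field_coord x v \<bullet> b"
  by (rule L_coord_derivative[OF smooth_log_component]) (auto intro!: derivative_eq_intros)

lemma L_L_log_component:
  "L u (L v (\<lambda>x. inv E x \<bullet> b)) (E x) = dP x v (field_coord x u) \<bullet> b"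
proof (rule L_coord_derivative)
  show "smooth_fun \<A> (L v (\<lambda>x. inv E x \<bullet> b))"
    using left_invariant_L smooth_log_component unfolding left_invariant_field_def by blast
  show "((\<lambda>w. L v (\<lambda>x. inv E x \<bullet> b) (E w)) has_derivative (\<lambda>h. dP x v h \<bullet> b)) (at x)"
    unfolding L_log_component by (intro has_derivative_inner_left has_derivative_P)
qed

text \<open>\<open>lie_bracket\<close> is an \<open>inv L\<close>, which is a true preimage because
  the commutator is again a left-invariant field and thus in the range of \<open>L\<close>.\<close>

lemma L_bracket: "L (lie_bracket L u v) = (\<lambda>f x. L u (L v f) x - L v (L u f) x)"
proof -
  have "left_invariant_field \<A> (\<lambda>f x. L u (L v f) x - L v (L u f) x)"
    by (intro left_invariant_field_commutator charts left_invariant_L)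
  then have "(\<lambda>f x. L u (L v f) x - L v (L u f) x) \<in> range L"
    using lie_algebra by (auto simp: lie_algebra_iso_def bij_betw_def)
  then show ?thesis unfolding lie_bracket_def by (rule f_inv_into_f)
qed

text \<open>Fields are operators on functions, so the identity is tested on the coordinate functions
  \<open>inv E x \<bullet> b\<close>: one field yields a component of \<open>field_coord\<close>, a
  second one the derivative of that component.\<close>

sublocale exponential_coordinates_bracket prod_coord field_coord "lie_bracket L"
proof
  fix x u v
  show "field_coord x (lie_bracket L u v) = dP x v (field_coord x u) - dP x u (field_coord x v)"
  proof (rule euclidean_eqI)
    fix b
    have "field_coord x (lie_bracket L u v) \<bullet> b =
        L u (L v (\<lambda>x. inv E x \<bullet> b)) (E x) - L v (L u (\<lambda>x. inv E x \<bullet> b)) (E x)"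
      by (simp only: L_log_component[symmetric] L_bracket)
    then show "field_coord x (lie_bracket L u v) \<bullet> b =
        (dP x v (field_coord x u) - dP x u (field_coord x v)) \<bullet> b"
      by (simp add: L_L_log_component inner_diff_left)
  qed
qed

lemma field_coord_dilation:
  assumes "s > 0"
  shows "field_coord (alg_dilation A s x) (alg_dilation A s v) = alg_dilation A s (field_coord x v)"
  using dilation_morphism[OF assms] by (intro P_equivariant) auto

end

subsection \<open>Left invariance of Lebesgue measure\<close>

text \<open>A well-ordered index type of cardinality \<open>DIM('a)\<close>: the change of variables theorem
  of the library is stated for \<open>real ^ 'n\<close> with such index types only.\<close>

typedef (overloaded) ('a::euclidean_space) dim_index = "{..<DIM('a)}"
  by (rule exI[of _ 0]) simp

lemma UNIV_dim_index: "(UNIV :: 'a::euclidean_space dim_index set) = Abs_dim_index ` {..<DIM('a)}"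
  using type_definition.Abs_image[OF type_definition_dim_index] by blast

instance dim_index :: (euclidean_space) finite
  by standard (simp add: UNIV_dim_index)

lemma card_dim_index: "CARD('a::euclidean_space dim_index) = DIM('a)"
  using type_definition.card[OF type_definition_dim_index, where 'a1='a] by simp

instantiation dim_index :: (euclidean_space) wellorder
begin

definition less_eq_dim_index where "x \<le> y \<longleftrightarrow> Rep_dim_index x \<le> Rep_dim_index y"
definition less_dim_index where "x < y \<longleftrightarrow> Rep_dim_index x < Rep_dim_index y"

instance
proof
  fix P :: "'a dim_index \<Rightarrow> bool" and a
  assume *: "\<And>x. (\<And>y. y < x \<Longrightarrow> P y) \<Longrightarrow> P x"
  show "P a"
    by (induction a rule: measure_induct_rule[of Rep_dim_index])
       (use * in \<open>simp add: less_dim_index_def\<close>)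
qed (auto simp: less_eq_dim_index_def less_dim_index_def Rep_dim_index_inject)

end

text \<open>\<open>S\<close> builds a vector from its coefficients in a basis of eigenvectors of
  \<open>A\<close>, and \<open>T\<close> reads the coefficients off. In these coordinates every
  dilation is diagonal.\<close>

locale eigenbasis =
  fixes A :: "'v::euclidean_space \<Rightarrow> 'v"
    and T :: "'v \<Rightarrow> real ^ 'v dim_index" and S :: "real ^ 'v dim_index \<Rightarrow> 'v"
    and \<mu> :: "'v dim_index \<Rightarrow> real"
  assumes linear_T: "linear T" and linear_S: "linear S"
    and T_S [simp]: "T (S w) = w" and S_T [simp]: "S (T v) = v"
    and mu_pos: "\<mu> i > 0"
    and A_S: "A (S w) = S (\<chi> i. \<mu> i * w $ i)"

lemma eigenbasis_exists:
  fixes A :: "'v::euclidean_space \<Rightarrow> 'v"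
  assumes "linear A" "diagonalisable_pos A"
  shows "\<exists>T S \<mu>. eigenbasis A T S \<mu>"
proof -
  obtain B where B: "independent B" "span B = UNIV" "\<And>b. b \<in> B \<Longrightarrow> \<exists>\<mu>>0. A b = \<mu> *\<^sub>R b"
    using assms(2) by (auto simp: diagonalisable_pos_def)
  have "finite B" using B(1) finiteI_independent by blast
  moreover have "card B = DIM('v)" using B(1,2) by (metis dim_UNIV dim_span_eq_card_independent)
  ultimately obtain \<beta> where \<beta>: "bij_betw \<beta> (UNIV :: 'v dim_index set) B"
    using finite_same_card_bij[of "UNIV :: 'v dim_index set" B] by (auto simp: card_dim_index)
  have "\<exists>\<mu>>0. A (\<beta> i) = \<mu> *\<^sub>R \<beta> i" for i using B(3) \<beta> by (auto simp: bij_betw_def)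
  then obtain \<mu> where \<mu>: "\<And>i. \<mu> i > 0" "\<And>i. A (\<beta> i) = \<mu> i *\<^sub>R \<beta> i" by metis
  define S where "S w = (\<Sum>i\<in>UNIV. w $ i *\<^sub>R \<beta> i)" for w :: "real ^ 'v dim_index"
  have linS: "linear S"
    by (rule linearI) (simp_all add: S_def algebra_simps sum.distrib scaleR_sum_right)
  have "v \<in> range S" for v
  proof -
    have "v \<in> span B" using B by simp
    then obtain u where u: "v = (\<Sum>b\<in>B. u b *\<^sub>R b)" using span_finite[OF \<open>finite B\<close>] by auto
    have "S (\<chi> i. u (\<beta> i)) = v" using sum.reindex_bij_betw[OF \<beta>] by (simp add: S_def u)
    then show ?thesis by (metis rangeI)
  qed
  then have "surj S" by blast
  then obtain T where "linear T" "\<And>w. T (S w) = w" "\<And>v. S (T v) = v"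
    using linear_surjective_isomorphism[OF linS] by (auto simp: card_dim_index)
  moreover have "A (S w) = S (\<chi> i. \<mu> i * w $ i)" for w
    by (simp add: S_def linear_sum[OF assms(1)] linear_cmul[OF assms(1)] \<mu>(2) mult.commute)
  ultimately show ?thesis using \<mu>(1) linS by (intro exI) (rule eigenbasis.intro)
qed

section \<open>Trace and dilations in eigencoordinates\<close>

context eigenbasis
begin

text \<open>Independence of the trace from the basis. After the sums are swapped, the inner one is
  the \<open>i\<close>-th coefficient of the \<open>i\<close>-th eigenvector, which is 1.\<close>

lemma homogeneous_dimension_eq: "homogeneous_dimension A = sum \<mu> UNIV"
proof -
  define \<beta> where "\<beta> i = S (axis i 1)" for i
  have S: "S w = (\<Sum>i\<in>UNIV. w $ i *\<^sub>R \<beta> i)" for w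
    by (subst basis_expansion[symmetric, of w])
       (simp add: scalar_mult_eq_scaleR linear_sum[OF linear_S] linear_cmul[OF linear_S] \<beta>_def)
  have A: "A b = (\<Sum>i\<in>UNIV. (\<mu> i * T b $ i) *\<^sub>R \<beta> i)" for b
    using A_S[of "T b"] S[of "\<chi> i. \<mu> i * T b $ i"] by simp
  have "homogeneous_dimension A = (\<Sum>b\<in>Basis. \<Sum>i\<in>UNIV. \<mu> i * T b $ i * (\<beta> i \<bullet> b))"
    by (simp add: homogeneous_dimension_def A inner_sum_left)
  also have "\<dots> = (\<Sum>i\<in>UNIV. \<mu> i * (\<Sum>b\<in>Basis. (\<beta> i \<bullet> b) * T b $ i))"
    by (subst sum.swap) (simp add: sum_distrib_left algebra_simps)
  also have "\<dots> = sum \<mu> UNIV"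
  proof (rule sum.cong)
    fix i
    have "(\<Sum>b\<in>Basis. (\<beta> i \<bullet> b) * T b $ i) = T (\<Sum>b\<in>Basis. (\<beta> i \<bullet> b) *\<^sub>R b) $ i"
      by (simp add: linear_sum[OF linear_T] linear_cmul[OF linear_T])
    also have "\<dots> = 1" by (simp add: euclidean_representation \<beta>_def)
    finally show "\<mu> i * (\<Sum>b\<in>Basis. (\<beta> i \<bullet> b) * T b $ i) = \<mu> i" by simp
  qed simp
  finally show ?thesis .
qed

lemma alg_dilation_S:
  assumes "s > 0"
  shows "alg_dilation A s (S w) = S (\<chi> i. s powr \<mu> i * w $ i)"
proof -
  have "bounded_linear S" using linear_S by (simp add: linear_conv_bounded_linear)
  have pow: "((\<lambda>w. ln s *\<^sub>R A w) ^^ k) (S w) = S (\<chi> i. (ln s * \<mu> i) ^ k * w $ i)" for k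
  proof (induction k)
    case (Suc k)
    have "((\<lambda>w. ln s *\<^sub>R A w) ^^ Suc k) (S w) = ln s *\<^sub>R S (\<chi> i. \<mu> i * ((ln s * \<mu> i) ^ k * w $ i))"
      by (simp add: Suc A_S)
    also have "\<dots> = S (\<chi> i. (ln s * \<mu> i) ^ Suc k * w $ i)"
      unfolding linear_cmul[OF linear_S, symmetric]
      by (rule arg_cong[where f = S]) (simp add: vec_eq_iff algebra_simps)
    finally show ?case .
  qed simp
  have "(\<lambda>k. (\<chi> i. (ln s * \<mu> i) ^ k /\<^sub>R fact k * w $ i)) sums (\<chi> i. s powr \<mu> i * w $ i)"
    unfolding sums_def
  proof (rule vec_tendstoI)
    fix i
    have "(\<lambda>k. (ln s * \<mu> i) ^ k /\<^sub>R fact k * w $ i) sums (exp (ln s * \<mu> i) * w $ i)"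
      by (intro sums_mult2 exp_converges)
    then show "(\<lambda>n. (\<Sum>k<n. (\<chi> i. (ln s * \<mu> i) ^ k /\<^sub>R fact k * w $ i)) $ i)
        \<longlonglongrightarrow> (\<chi> i. s powr \<mu> i * w $ i) $ i"
      using assms by (simp add: sums_def powr_def mult.commute)
  qed
  from bounded_linear.sums[OF \<open>bounded_linear S\<close> this]
  have "(\<lambda>k. (1 / fact k) *\<^sub>R ((\<lambda>w. ln s *\<^sub>R A w) ^^ k) (S w)) sums S (\<chi> i. s powr \<mu> i * w $ i)"
  proof (rule sums_cong[THEN iffD1, rotated])
    fix k
    have "(\<chi> i. (ln s * \<mu> i) ^ k /\<^sub>R fact k * w $ i) = (1 / fact k) *\<^sub>R (\<chi> i. (ln s * \<mu> i) ^ k * w $ i)"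
      by (simp add: vec_eq_iff divide_simps)
    then show "S (\<chi> i. (ln s * \<mu> i) ^ k /\<^sub>R fact k * w $ i) =
        (1 / fact k) *\<^sub>R ((\<lambda>w. ln s *\<^sub>R A w) ^^ k) (S w)"
      unfolding pow by (simp only: linear_cmul[OF linear_S])
  qed
  then show ?thesis unfolding alg_dilation_def by (rule sums_unique[symmetric])
qed

lemma alg_dilation_eq:
  "s > 0 \<Longrightarrow> alg_dilation A s v = S (\<chi> i. s powr \<mu> i * T v $ i)"
  using alg_dilation_S[of s "T v"] by simp

end

section \<open>Volume-preserving maps and uniqueness of invariant measures\<close>

lemma continuous_on_det:
  fixes M :: "'a::topological_space \<Rightarrow> real ^ 'n ^ 'n"
  assumes "\<And>i j. continuous_on X (\<lambda>x. M x $ i $ j)"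
  shows "continuous_on X (\<lambda>x. det (M x))"
  unfolding det_def by (intro continuous_intros assms)

text \<open>The preimage of a box under \<psi> is its image under the inverse \<phi>, so the
  Jacobian condition is put on \<phi>, while continuity of \<psi> gives measurability.\<close>

lemma lborel_distr_unimodular:
  fixes \<phi> \<psi> :: "real ^ 'n::{finite,wellorder} \<Rightarrow> real ^ 'n::_"
  assumes \<phi>: "\<And>x. (\<phi> has_derivative \<phi>' x) (at x)" and det: "\<And>x. \<bar>det (matrix (\<phi>' x))\<bar> = 1"
    and inv: "\<And>x. \<phi> (\<psi> x) = x" "\<And>x. \<psi> (\<phi> x) = x" and \<psi>: "continuous_on UNIV \<psi>"
  shows "distr lborel borel \<psi> = lborel"
proof (rule lborel_eqI[symmetric])
  fix l u :: "real ^ 'n::_" assume lu: "\<And>b. b \<in> Basis \<Longrightarrow> l \<bullet> b \<le> u \<bullet> b"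
  have "inj_on \<phi> (box l u)" using inv(2) by (metis inj_onI)
  moreover have "((\<lambda>x. \<bar>det (matrix (\<phi>' x))\<bar>) has_integral measure lborel (box l u)) (box l u)"
    unfolding det using has_integral_measure_lborel[of "box l u"] by (simp add: emeasure_lborel_box_eq)
  ultimately have 1: "\<phi> ` box l u \<in> lmeasurable \<and>
      measure lebesgue (\<phi> ` box l u) = measure lborel (box l u)"
    using \<phi> by (intro has_measure_differentiable_image[THEN iffD2])
      (auto intro: has_derivative_at_withinI)
  have im: "\<psi> -` box l u = \<phi> ` box l u" using inv by (auto simp: image_def) metis
  have mb: "\<psi> \<in> borel_measurable borel" using \<psi> by (rule borel_measurable_continuous_onI)
  then have b: "\<psi> -` box l u \<in> sets borel" using measurable_sets[OF mb, of "box l u"] by simp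
  have "emeasure (distr lborel borel \<psi>) (box l u) = emeasure lborel (\<phi> ` box l u)"
    using mb by (subst emeasure_distr) (auto simp: im)
  also have "\<dots> = emeasure lebesgue (\<phi> ` box l u)"
    using b by (simp add: im)
  also have "\<dots> = ennreal (measure lborel (box l u))"
    using 1 emeasure_eq_measure2 fmeasurableD2 by (metis)
  also have "\<dots> = emeasure lborel (box l u)"
    by (intro emeasure_eq_ennreal_measure[symmetric]) (simp add: emeasure_lborel_box_eq)
  finally show "emeasure (distr lborel borel \<psi>) (box l u) = ennreal (\<Prod>b\<in>Basis. (u - l) \<bullet> b)"
    using lu by (simp add: emeasure_lborel_box)
qed simp

text \<open>The right side depends on \<mu> only through the number \<open>emeasure \<mu> U\<close>,
  which is the reason for uniqueness. It results from two applications of Fubini's theorem, with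
  left translations in between.\<close>

lemma haar_measure_key:
  fixes \<mu> \<nu> :: "'g::{topological_group_add, second_countable_topology} measure"
  assumes sets [measurable_cong, simp]: "sets \<mu> = sets borel" "sets \<nu> = sets borel"
    and sf: "sigma_finite_measure \<mu>" "sigma_finite_measure \<nu>"
    and inv: "\<And>x. distr \<mu> borel ((+) x) = \<mu>" "\<And>x. distr \<nu> borel ((+) x) = \<nu>"
    and U [measurable]: "U \<in> sets borel"
    and U_pos: "\<And>x. emeasure \<nu> {t. t + x \<in> U} \<noteq> 0" and U_fin: "\<And>x. emeasure \<nu> {t. t + x \<in> U} \<noteq> \<infinity>"
    and B [measurable]: "B \<in> sets borel"
  shows "emeasure \<mu> B = emeasure \<mu> U * (\<integral>\<^sup>+y. indicator B (- y) / emeasure \<nu> {t. t - y \<in> U} \<partial>\<nu>)"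
proof -
  interpret \<mu>: sigma_finite_measure \<mu> by (rule sf)
  interpret \<nu>: sigma_finite_measure \<nu> by (rule sf)
  interpret pair_sigma_finite \<mu> \<nu> ..
  have [measurable]: "(\<lambda>z::'g \<times> 'g. fst z + snd z) \<in> borel_measurable borel"
    by (intro borel_measurable_continuous_onI continuous_on_add continuous_on_fst continuous_on_snd continuous_on_id)
  have plus: "(\<lambda>z::'g \<times> 'g. fst z + snd z) \<in> borel_measurable (borel \<Otimes>\<^sub>M borel)"
    unfolding borel_prod by measurable
  have [measurable]: "(\<lambda>x. f x + g x) \<in> borel_measurable N"
    if [measurable]: "f \<in> borel_measurable N" "g \<in> borel_measurable N" for f g :: "_ \<Rightarrow> 'g" and N :: "'c measure"
    using measurable_compose[OF measurable_Pair plus, of f N g] that by simp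
  have [measurable]: "(uminus :: 'g \<Rightarrow> 'g) \<in> borel_measurable borel"
    by (intro borel_measurable_continuous_onI) (auto simp: continuous_on_def intro!: tendsto_intros)
  have inv\<mu>: "(\<integral>\<^sup>+x. f (z + x) \<partial>\<mu>) = (\<integral>\<^sup>+x. f x \<partial>\<mu>)" if [measurable]: "f \<in> borel_measurable borel" for f z
    by (subst (2) inv(1)[of z, symmetric], subst nn_integral_distr) auto
  have inv\<nu>: "(\<integral>\<^sup>+x. f (z + x) \<partial>\<nu>) = (\<integral>\<^sup>+x. f x \<partial>\<nu>)" if [measurable]: "f \<in> borel_measurable borel" for f z
    by (subst (2) inv(2)[of z, symmetric], subst nn_integral_distr) auto
  \<comment> \<open>The \<nu>-measure of a right translate of \<open>U\<close>, which may vary with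
    \<open>x\<close> since \<nu> is only left-invariant.\<close>
  define F where "F x = (\<integral>\<^sup>+t. indicator U (t + x) \<partial>\<nu>)" for x
  have F: "F x = emeasure \<nu> {t. t + x \<in> U}" for x
  proof -
    have "F x = (\<integral>\<^sup>+t. indicator {t. t + x \<in> U} t \<partial>\<nu>)" by (simp add: F_def indicator_def)
    also have "\<dots> = emeasure \<nu> {t. t + x \<in> U}" by (rule nn_integral_indicator) measurable
    finally show ?thesis .
  qed
  have [measurable]: "F \<in> borel_measurable borel" unfolding F_def[abs_def] by measurable
  \<comment> \<open>Chosen so that \<open>F x * h (- x)\<close> is the indicator of
    \<open>B\<close>; the assumptions on \<open>U\<close> make the division legitimate.\<close>
  define h where "h y = indicator B (- y) / F (- y)" for y
  have [measurable]: "h \<in> borel_measurable borel" unfolding h_def[abs_def] by measurable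
  have "emeasure \<mu> U * (\<integral>\<^sup>+y. h y \<partial>\<nu>) = (\<integral>\<^sup>+x. indicator U x * (\<integral>\<^sup>+y. h y \<partial>\<nu>) \<partial>\<mu>)"
    by (simp add: nn_integral_multc)
  also have "\<dots> = (\<integral>\<^sup>+x. \<integral>\<^sup>+y. indicator U x * h (- x + y) \<partial>\<nu> \<partial>\<mu>)"
    by (simp add: nn_integral_cmult inv\<nu>)
  also have "\<dots> = (\<integral>\<^sup>+y. \<integral>\<^sup>+x. indicator U x * h (- x + y) \<partial>\<mu> \<partial>\<nu>)"
    by (rule Fubini'[symmetric]) (simp add: case_prod_unfold, measurable)
  \<comment> \<open>After this translation of \<open>x\<close> by \<open>y\<close>, the argument of
    \<open>h\<close> collapses to \<open>- x\<close> and \<open>y\<close> survives only in the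
    indicator of \<open>U\<close>.\<close>
  also have "\<dots> = (\<integral>\<^sup>+y. \<integral>\<^sup>+x. indicator U (y + x) * h (- (y + x) + y) \<partial>\<mu> \<partial>\<nu>)"
    by (rule nn_integral_cong, rule inv\<mu>[symmetric]) measurable
  also have "\<dots> = (\<integral>\<^sup>+y. \<integral>\<^sup>+x. indicator U (y + x) * h (- x) \<partial>\<mu> \<partial>\<nu>)"
    by (simp add: minus_add add.assoc)
  also have "\<dots> = (\<integral>\<^sup>+x. \<integral>\<^sup>+y. indicator U (y + x) * h (- x) \<partial>\<nu> \<partial>\<mu>)"
    by (rule Fubini') (simp add: case_prod_unfold, measurable)
  also have "\<dots> = (\<integral>\<^sup>+x. F x * h (- x) \<partial>\<mu>)"
    by (simp add: nn_integral_multc F_def)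
  also have "\<dots> = (\<integral>\<^sup>+x. indicator B x \<partial>\<mu>)"
  proof (rule nn_integral_cong)
    fix x
    show "F x * h (- x) = indicator B x"
      using U_pos[of x] U_fin[of x]
      by (simp add: h_def F ennreal_times_divide mult_divide_eq_ennreal mult.commute)
  qed
  also have "\<dots> = emeasure \<mu> B" by simp
  finally show ?thesis by (simp add: h_def F)
qed

text \<open>\<open>haar_measure_key\<close> is used for \<mu> and for \<nu> in place of \<mu>, with
  the same reference measure \<nu>: the integral over \<nu> is common to both.\<close>

lemma haar_measure_unique:
  fixes \<mu> \<nu> :: "'g::{topological_group_add, second_countable_topology} measure"
  assumes "sets \<mu> = sets borel" "sets \<nu> = sets borel"
    and "sigma_finite_measure \<mu>" "sigma_finite_measure \<nu>"
    and "\<And>x. distr \<mu> borel ((+) x) = \<mu>" "\<And>x. distr \<nu> borel ((+) x) = \<nu>"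
    and "U \<in> sets borel"
    and "\<And>x. emeasure \<nu> {t. t + x \<in> U} \<noteq> 0" "\<And>x. emeasure \<nu> {t. t + x \<in> U} \<noteq> \<infinity>"
    and "B \<in> sets borel"
  shows "emeasure \<nu> U * emeasure \<mu> B = emeasure \<mu> U * emeasure \<nu> B"
  using haar_measure_key[of \<mu> \<nu> U B] haar_measure_key[of \<nu> \<nu> U B] assms by (simp add: mult_ac)

section \<open>An explicit invariant measure and its scaling\<close>

locale graded_coordinates = homogeneous_group \<A> L E A + eigenbasis A T S \<mu>
  for \<A> :: "('g::{topological_group_add, t2_space, second_countable_topology},
             'v::euclidean_space) atlas"
    and L E A T S \<mu>
begin

definition field_matrix :: "'v \<Rightarrow> real ^ 'v dim_index ^ 'v dim_index" where
  "field_matrix x = matrix (\<lambda>w. T (field_coord x (S w)))"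

lemma linear_field: "linear (\<lambda>w. T (field_coord x (S w)))"
  using linear_compose[OF linear_compose[OF linear_S linear_P] linear_T] by (simp add: comp_def)

text \<open>By \<open>field_coord_dilation\<close> the two matrices are conjugate through the
  diagonal matrix of the dilation, whose determinant is nonzero.\<close>

lemma field_matrix_dilation:
  assumes "s > 0"
  shows "det (field_matrix (alg_dilation A s x)) = det (field_matrix x)"
proof -
  define \<delta> where "\<delta> w = (\<chi> i. s powr \<mu> i * w $ i)" for w :: "real ^ 'v dim_index"
  have \<delta>: "linear \<delta>" by (rule linearI) (simp_all add: \<delta>_def vec_eq_iff algebra_simps)
  have D: "alg_dilation A s (S w) = S (\<delta> w)" for w using alg_dilation_S[OF assms] by (simp add: \<delta>_def)
  have "T (field_coord (alg_dilation A s x) (S (\<delta> w))) = \<delta> (T (field_coord x (S w)))" for w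
    using field_coord_dilation[OF assms, of x "S w"] D[of "T (field_coord x (S w))"]
    by (simp add: D)
  then have "(\<lambda>w. T (field_coord (alg_dilation A s x) (S w))) \<circ> \<delta> = \<delta> \<circ> (\<lambda>w. T (field_coord x (S w)))"
    by (simp add: fun_eq_iff)
  then have "field_matrix (alg_dilation A s x) ** matrix \<delta> = matrix \<delta> ** field_matrix x"
    unfolding field_matrix_def
    by (simp only: matrix_compose[OF \<delta> linear_field, symmetric] matrix_compose[OF linear_field \<delta>, symmetric])
  then have "det (field_matrix (alg_dilation A s x)) * det (matrix \<delta>) = det (matrix \<delta>) * det (field_matrix x)"
    by (metis det_mul)
  moreover have "det (matrix \<delta>) \<noteq> 0"
    using assms by (subst det_diagonal) (auto simp: matrix_def \<delta>_def axis_def)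
  ultimately show ?thesis by simp
qed

text \<open>Here positivity of the eigenvalues enters: each coordinate carries a positive power of
  \<open>1 / Suc n\<close>.\<close>

lemma dilation_tendsto_zero: "(\<lambda>n. alg_dilation A (1 / Suc n) x) \<longlonglongrightarrow> 0"
proof -
  have "(\<lambda>n. \<chi> i. (1 / Suc n) powr \<mu> i * T x $ i) \<longlonglongrightarrow> 0"
  proof (rule vec_tendstoI)
    fix i
    have "(\<lambda>n. (1 / real (Suc n)) powr \<mu> i) \<longlonglongrightarrow> 0 powr \<mu> i"
      using LIMSEQ_inverse_real_of_nat mu_pos[of i]
      by (intro tendsto_powr2) (auto simp: inverse_eq_divide)
    then have "(\<lambda>n. (1 / real (Suc n)) powr \<mu> i * T x $ i) \<longlonglongrightarrow> 0"
      using mu_pos[of i] by (auto intro: tendsto_mult_left_zero)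
    then show "(\<lambda>n. (\<chi> i. (1 / Suc n) powr \<mu> i * T x $ i) $ i) \<longlonglongrightarrow> 0 $ i" by simp
  qed
  moreover have "bounded_linear S" using linear_S by (simp add: linear_conv_bounded_linear)
  ultimately have "(\<lambda>n. S (\<chi> i. (1 / Suc n) powr \<mu> i * T x $ i)) \<longlonglongrightarrow> S 0"
    by (rule bounded_linear.tendsto[rotated])
  then show ?thesis by (simp add: alg_dilation_eq linear_0[OF linear_S])
qed

text \<open>The determinant is constant along dilation orbits, and these accumulate at the unit.\<close>

lemma det_field_matrix: "det (field_matrix x) = 1"
proof -
  have cont: "continuous_on UNIV (\<lambda>x. det (field_matrix x))"
  proof (rule continuous_on_det)
    fix i j
    have "continuous_on UNIV (\<lambda>x. T (field_coord x (S (axis j 1))))"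
      using linear_T smooth_on_continuous_on[OF smooth_P]
      by (auto simp: linear_conv_bounded_linear intro: bounded_linear.continuous_on)
    then have "continuous_on UNIV (\<lambda>x. T (field_coord x (S (axis j 1))) $ i)"
      by (intro continuous_on_component)
    then show "continuous_on UNIV (\<lambda>x. field_matrix x $ i $ j)"
      by (simp add: field_matrix_def matrix_def)
  qed
  then have "isCont (\<lambda>x. det (field_matrix x)) 0" by (simp add: continuous_on_eq_continuous_at)
  from isCont_tendsto_compose[OF this dilation_tendsto_zero[of x]]
  have "(\<lambda>n::nat. det (field_matrix x)) \<longlonglongrightarrow> det (field_matrix 0)"
    by (simp add: field_matrix_dilation)
  then have "det (field_matrix x) = det (field_matrix 0)" by (simp add: LIMSEQ_const_iff)
  also have "field_matrix 0 = mat 1"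
    by (simp add: field_matrix_def P_zero matrix_id_mat_1[unfolded id_def])
  finally show ?thesis by simp
qed

lemma det_translation: "det (matrix (\<lambda>w. T (D z x (S w)))) = 1"
proof -
  have lin: "linear (\<lambda>w. T (D z x (S w)))"
    using linear_compose[OF linear_compose[OF linear_S linear_D] linear_T] by (simp add: comp_def)
  have "(\<lambda>w. T (D z x (S w))) \<circ> (\<lambda>w. T (field_coord x (S w))) = (\<lambda>w. T (field_coord (prod_coord z x) (S w)))"
    by (simp add: fun_eq_iff D_P)
  then have "matrix (\<lambda>w. T (D z x (S w))) ** field_matrix x = field_matrix (prod_coord z x)"
    unfolding field_matrix_def by (simp only: matrix_compose[OF linear_field lin, symmetric])
  then show ?thesis by (metis det_field_matrix det_mul mult.right_neutral)
qed

lemma lborel_translation: "distr lborel borel (\<lambda>w. T (prod_coord z (S w))) = lborel"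
proof (rule lborel_distr_unimodular[where \<phi> = "\<lambda>w. T (prod_coord (- z) (S w))"
      and \<phi>' = "\<lambda>w h. T (D (- z) (S w) (S h))"])
  have S: "bounded_linear S" and T: "bounded_linear T"
    using linear_S linear_T by (auto simp: linear_conv_bounded_linear)
  have der: "((\<lambda>w. T (prod_coord z (S w))) has_derivative (\<lambda>h. T (D z (S w) (S h)))) (at w)" for z w
    by (intro bounded_linear.has_derivative[OF T]
        has_derivative_compose[OF bounded_linear_imp_has_derivative[OF S] has_derivative_m])
  show "((\<lambda>w. T (prod_coord (- z) (S w))) has_derivative (\<lambda>h. T (D (- z) (S w) (S h)))) (at w)" for w
    by (rule der)
  show "continuous_on UNIV (\<lambda>w. T (prod_coord z (S w)))"
    using der by (intro has_derivative_continuous_on[of _ _ "\<lambda>w h. T (D z (S w) (S h))"])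
      (auto intro: has_derivative_at_withinI)
qed (auto simp: det_translation assoc[symmetric] left_inverse right_inverse left_zero)

definition exp_lebesgue :: "'g measure" where
  "exp_lebesgue = distr lborel borel (\<lambda>w. E (S w))"

lemma continuous_exp: "continuous_on X (\<lambda>w. E (S w))"
proof -
  have "bounded_linear S" using linear_S by (simp add: linear_conv_bounded_linear)
  then have "continuous_on X S" by (rule linear_continuous_on)
  then show ?thesis
    by (rule continuous_on_compose2[OF smooth_map_continuous[OF exp_smooth]]) auto
qed

lemma continuous_log: "continuous_on X (\<lambda>x. T (inv E x))"
proof -
  have "bounded_linear T" using linear_T by (simp add: linear_conv_bounded_linear)
  moreover have "continuous_on X (inv E)"
    using smooth_map_continuous[OF log_smooth] continuous_on_subset by blast
  ultimately show ?thesis by (rule bounded_linear.continuous_on)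
qed

lemma measurable_exp [measurable]: "(\<lambda>w. E (S w)) \<in> borel_measurable borel"
  by (intro borel_measurable_continuous_onI continuous_exp)

lemma measurable_plus_left: "(+) (z::'g) \<in> borel_measurable borel"
  by (intro borel_measurable_continuous_onI continuous_on_add continuous_on_const continuous_on_id)

lemma exp_lebesgue_translation: "distr exp_lebesgue borel ((+) z) = exp_lebesgue"
proof -
  have [measurable]: "(\<lambda>w. T (prod_coord (inv E z) (S w))) \<in> borel_measurable borel"
  proof (rule borel_measurable_continuous_onI)
    have "continuous_on UNIV (\<lambda>w. T (inv E (z + E (S w))))"
      by (rule continuous_on_compose2[OF continuous_log[of UNIV]]) (auto intro!: continuous_intros continuous_exp)
    then show "continuous_on UNIV (\<lambda>w. T (prod_coord (inv E z) (S w)))"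
      by (simp add: prod_coord_def)
  qed
  note [measurable] = measurable_plus_left
  have "distr exp_lebesgue borel ((+) z) = distr lborel borel (\<lambda>w. z + E (S w))"
    unfolding exp_lebesgue_def by (subst distr_distr) (auto simp: comp_def)
  also have "(\<lambda>w. z + E (S w)) = (\<lambda>w. E (S w)) \<circ> (\<lambda>w. T (prod_coord (inv E z) (S w)))"
    by (simp add: fun_eq_iff exp_prod_coord)
  also have "distr lborel borel \<dots> = distr (distr lborel borel (\<lambda>w. T (prod_coord (inv E z) (S w)))) borel (\<lambda>w. E (S w))"
    by (subst distr_distr) auto
  finally show ?thesis by (simp add: lborel_translation exp_lebesgue_def)
qed

lemma dilation_exp: "s > 0 \<Longrightarrow> dilation E A s (E (S w)) = E (S (\<chi> i. s powr \<mu> i * w $ i))"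
  by (simp add: dilation_def alg_dilation_S)

lemma measurable_dilation:
  assumes "s > 0"
  shows "dilation E A s \<in> borel_measurable borel"
proof (rule borel_measurable_continuous_onI)
  have eq: "dilation E A s x = E (S (\<chi> i. s powr \<mu> i * T (inv E x) $ i))" for x
    using dilation_exp[OF assms, of "T (inv E x)"] by simp
  show "continuous_on UNIV (dilation E A s)"
    unfolding eq[abs_def]
    by (rule continuous_on_compose2[OF continuous_exp[of UNIV]])
       (auto intro!: continuous_intros continuous_log)
qed

text \<open>The push-forward measures a set by its preimage under the dilation, which has
  \<open>s powr (- Q)\<close> times the volume; the density compensates for this factor.\<close>

lemma exp_lebesgue_dilation:
  assumes s: "s > 0"
  shows "density (distr exp_lebesgue borel (dilation E A s)) (\<lambda>_. ennreal (s powr homogeneous_dimension A)) = exp_lebesgue"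
proof -
  define \<delta> where "\<delta> w = (\<chi> i. s powr \<mu> i * w $ i)" for w :: "real ^ 'v dim_index"
  \<comment> \<open>\<open>lborel_affine_euclidean\<close> takes scaling factors indexed by basis
    vectors; on \<open>axis i 1\<close> the exponent reduces to \<open>\<mu> i\<close>.\<close>
  define c where "c b = s powr (\<Sum>i\<in>UNIV. \<mu> i * b $ i)" for b :: "real ^ 'v dim_index"
  have c: "c (axis i 1) = s powr \<mu> i" for i
    by (simp add: c_def axis_def if_distrib cong: if_cong)
  have Basis: "(Basis :: (real ^ 'v dim_index) set) = range (\<lambda>i. axis i 1)"
    by (auto simp: Basis_vec_def)
  have inj: "inj (\<lambda>i::'v dim_index. axis i (1::real))" by (auto simp: inj_on_def axis_eq_axis)
  have "0 + (\<Sum>j\<in>Basis. (c j * (w \<bullet> j)) *\<^sub>R j) = \<delta> w" for w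
  proof (rule euclidean_eqI)
    fix b :: "real ^ 'v dim_index" assume b: "b \<in> Basis"
    then obtain i where "b = axis i 1" unfolding Basis by blast
    then have "c b * (w \<bullet> b) = \<delta> w \<bullet> b" by (simp add: c inner_axis \<delta>_def)
    then show "(0 + (\<Sum>j\<in>Basis. (c j * (w \<bullet> j)) *\<^sub>R j)) \<bullet> b = \<delta> w \<bullet> b"
      using inner_sum_left_Basis[OF b, of "\<lambda>j. c j * (w \<bullet> j)"] by simp
  qed
  moreover have "(\<Prod>j\<in>Basis. \<bar>c j\<bar>) = s powr homogeneous_dimension A"
    unfolding Basis homogeneous_dimension_eq using s
    by (subst prod.reindex[OF inj]) (simp add: c powr_sum)
  ultimately have l: "lborel = density (distr lborel borel \<delta>) (\<lambda>_. ennreal (s powr homogeneous_dimension A))"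
    using lborel_affine_euclidean[of c 0] s by (simp add: c_def cong: if_cong)
  have [measurable]: "\<delta> \<in> borel_measurable borel"
    by (intro borel_measurable_continuous_onI) (auto simp: \<delta>_def[abs_def] intro!: continuous_intros)
  note [measurable] = measurable_dilation[OF s]
  have "distr exp_lebesgue borel (dilation E A s) = distr lborel borel (\<lambda>w. dilation E A s (E (S w)))"
    unfolding exp_lebesgue_def by (subst distr_distr) (auto simp: comp_def)
  also have "(\<lambda>w. dilation E A s (E (S w))) = (\<lambda>w. E (S w)) \<circ> \<delta>"
    by (simp add: fun_eq_iff dilation_exp[OF s] \<delta>_def)
  also have "distr lborel borel \<dots> = distr (distr lborel borel \<delta>) borel (\<lambda>w. E (S w))"
    by (subst distr_distr) auto
  finally have "density (distr exp_lebesgue borel (dilation E A s)) (\<lambda>_. ennreal (s powr homogeneous_dimension A)) =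
     density (distr (distr lborel borel \<delta>) borel (\<lambda>w. E (S w))) (\<lambda>_. ennreal (s powr homogeneous_dimension A))"
    by simp
  also have "\<dots> = exp_lebesgue"
    by (subst density_distr) (auto simp: exp_lebesgue_def l[symmetric])
  finally show ?thesis .
qed

end

subsection \<open>Haar measure and dilations\<close>

lemma emeasure_lborel_open_nonzero:
  fixes V :: "'a::euclidean_space set"
  assumes "open V" "V \<noteq> {}"
  shows "emeasure lborel V \<noteq> 0"
proof
  assume "emeasure lborel V = 0"
  then have "V \<in> null_sets lborel" using assms(1) by (auto simp: null_sets_def)
  then have "V \<in> null_sets lebesgue" by (rule null_sets_completionI)
  then show False using open_not_negligible[OF assms] by (simp add: negligible_iff_null_sets)
qed

text \<open>Passes from the invariance of images in \<open>haar_measure\<close> to the invariance of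
  preimages contained in \<open>distr\<close>; the two are exchanged by the inverse
  translation.\<close>

lemma haar_measure_translation:
  fixes M :: "'g::topological_group_add measure"
  assumes "haar_measure M"
  shows "distr M borel ((+) z) = M"
proof (rule measure_eqI)
  have sets: "sets M = sets borel" using assms by (simp add: haar_measure_def)
  then show "sets (distr M borel ((+) z)) = sets M" by simp
  fix B assume "B \<in> sets (distr M borel ((+) z))"
  then have B: "B \<in> sets borel" by simp
  have sp: "space M = UNIV" using sets_eq_imp_space_eq[OF sets] by simp
  have "(+) z \<in> borel_measurable borel"
    by (intro borel_measurable_continuous_onI continuous_on_add continuous_on_const continuous_on_id)
  then have "(+) z \<in> borel_measurable M" using measurable_cong_sets[OF sets refl] by blast
  moreover have "(+) z -` B = (+) (- z) ` B"
  proof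
    show "(+) z -` B \<subseteq> (+) (- z) ` B"
    proof
      fix x assume "x \<in> (+) z -` B"
      then show "x \<in> (+) (- z) ` B" by (intro image_eqI[of _ _ "z + x"]) (auto simp: add.assoc[symmetric])
    qed
  qed (auto simp: add.assoc[symmetric])
  ultimately have "emeasure (distr M borel ((+) z)) B = emeasure M ((+) (- z) ` B)"
    using B by (simp add: emeasure_distr sp)
  also have "\<dots> = emeasure M B" using assms B by (simp add: haar_measure_def)
  finally show "emeasure (distr M borel ((+) z)) B = emeasure M B" .
qed

section \<open>Scaling of an arbitrary Haar measure and its infinitesimal form\<close>

context graded_coordinates
begin

lemma log_exp_S [simp]: "T (inv E (E (S w))) = w" and exp_S_log [simp]: "E (S (T (inv E x))) = x"
  by simp_all

lemma exp_vimage: "(\<lambda>w. E (S w)) -` X = (\<lambda>x. T (inv E x)) ` X"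
  by (auto simp: image_iff) (metis log_exp_S)

lemma exp_image: "(\<lambda>w. E (S w)) ` X = (\<lambda>x. T (inv E x)) -` X"
  by (auto simp: image_iff) (metis exp_S_log)

lemma sigma_finite_if_finite_on_compact:
  fixes M :: "'g measure"
  assumes sets: "sets M = sets borel" and fin: "\<And>K. compact K \<Longrightarrow> emeasure M K < \<infinity>"
  shows "sigma_finite_measure M"
proof
  define K where "K n = (\<lambda>w. E (S w)) ` cball 0 (real n)" for n
  have c: "compact (K n)" for n
    unfolding K_def by (intro compact_continuous_image continuous_exp compact_cball)
  have "x \<in> (\<Union>n. K n)" for x
  proof -
    obtain n where "norm (T (inv E x)) \<le> real n" using real_arch_simple by blast
    then have "x \<in> K n" unfolding K_def by (intro image_eqI[of _ _ "T (inv E x)"]) auto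
    then show ?thesis by blast
  qed
  then show "\<exists>X. countable X \<and> X \<subseteq> sets M \<and> \<Union> X = space M \<and> (\<forall>a\<in>X. emeasure M a \<noteq> \<infinity>)"
    using c fin[OF c] sets sets_eq_imp_space_eq[OF sets]
    by (intro exI[of _ "range K"]) (auto intro: borel_closed compact_imp_closed simp: less_top[symmetric])
qed

lemma sets_exp_lebesgue [simp]: "sets exp_lebesgue = sets borel"
  by (simp add: exp_lebesgue_def)

lemma emeasure_exp_lebesgue:
  assumes "B \<in> sets borel"
  shows "emeasure exp_lebesgue B = emeasure lborel ((\<lambda>x. T (inv E x)) ` B)"
  using assms by (simp add: exp_lebesgue_def emeasure_distr exp_vimage)

lemma exp_lebesgue_compact:
  assumes "compact K"
  shows "emeasure exp_lebesgue K < \<infinity>"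
proof -
  have "compact ((\<lambda>x. T (inv E x)) ` K)"
    by (intro compact_continuous_image continuous_log assms)
  then show ?thesis
    using assms emeasure_bounded_finite[OF compact_imp_bounded]
    by (simp add: emeasure_exp_lebesgue borel_closed compact_imp_closed)
qed

lemma exp_lebesgue_open:
  assumes "open V" "V \<noteq> {}"
  shows "emeasure exp_lebesgue V \<noteq> 0"
proof -
  have "open ((\<lambda>x. T (inv E x)) ` V)"
    unfolding exp_vimage[symmetric] by (intro open_vimage assms continuous_exp)
  then show ?thesis
    using assms emeasure_lborel_open_nonzero[of "(\<lambda>x. T (inv E x)) ` V"]
    by (simp add: emeasure_exp_lebesgue)
qed

lemma haar_measure_dilation:
  assumes M: "haar_measure M" and s: "s > 0"
  shows "density (distr M borel (dilation E A s)) (\<lambda>_. ennreal (s powr homogeneous_dimension A)) = M"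
proof -
  have sets: "sets M = sets borel" and fin: "\<And>K. compact K \<Longrightarrow> emeasure M K < \<infinity>"
    using M by (auto simp: haar_measure_def)
  have sp: "space M = UNIV" "space exp_lebesgue = UNIV"
    using sets_eq_imp_space_eq[OF sets] sets_eq_imp_space_eq[OF sets_exp_lebesgue] by auto
  \<comment> \<open>An open set with compact closure: its right translates are nonempty, open and
    contained in compact sets, so they have positive finite measure, as
    \<open>haar_measure_unique\<close> requires.\<close>
  define U where "U = (\<lambda>w. E (S w)) ` ball 0 1"
  have "open U"
    unfolding U_def exp_image by (intro open_vimage continuous_log open_ball)
  define U' where "U' x = {t. t + x \<in> U}" for x
  have U': "open (U' x)" "U' x \<noteq> {}" "emeasure exp_lebesgue (U' x) < \<infinity>" for x
  proof -
    have "continuous_on UNIV (\<lambda>t. t + x)" by (intro continuous_on_add continuous_on_const continuous_on_id)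
    then show "open (U' x)"
      using open_vimage[OF \<open>open U\<close>] by (simp add: U'_def vimage_def)
    have "E (S 0) + - x \<in> U' x" by (auto simp: U'_def U_def add.assoc)
    then show "U' x \<noteq> {}" by blast
    have "compact ((\<lambda>w. E (S w) + - x) ` cball 0 1)"
      by (intro compact_continuous_image continuous_on_add continuous_exp continuous_on_const compact_cball)
    moreover have "U' x \<subseteq> (\<lambda>w. E (S w) + - x) ` cball 0 1"
    proof
      fix t assume "t \<in> U' x"
      then obtain w where "t + x = E (S w)" "w \<in> ball 0 1" by (auto simp: U'_def U_def)
      then show "t \<in> (\<lambda>w. E (S w) + - x) ` cball 0 1"
        by (intro image_eqI[of _ _ w]) (auto simp: add.assoc dest: sym)
    qed
    ultimately show "emeasure exp_lebesgue (U' x) < \<infinity>"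
      using emeasure_mono[of "U' x" _ exp_lebesgue] exp_lebesgue_compact
      by (metis borel_closed compact_imp_closed order.strict_trans1 sets_exp_lebesgue)
  qed
  define k where "k = ennreal (s powr homogeneous_dimension A)"
  define e where "e = emeasure exp_lebesgue U"
  have eU: "e \<noteq> 0" "e \<noteq> \<infinity>"
    using exp_lebesgue_open[OF U'(1,2), of 0] U'(3)[of 0] by (auto simp: U'_def e_def)
  have uniq: "e * emeasure M B = emeasure M U * emeasure exp_lebesgue B"
    if "B \<in> sets borel" for B
    unfolding e_def
  proof (rule haar_measure_unique)
    show "emeasure exp_lebesgue {t. t + x \<in> U} \<noteq> 0" "emeasure exp_lebesgue {t. t + x \<in> U} \<noteq> \<infinity>" for x
      using exp_lebesgue_open[OF U'(1,2), of x] U'(3)[of x] by (auto simp: U'_def)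
  qed (use that sets \<open>open U\<close> in \<open>auto intro: sigma_finite_if_finite_on_compact fin exp_lebesgue_compact
       haar_measure_translation[OF M] exp_lebesgue_translation\<close>)
  have scaled: "k * emeasure \<nu> (dilation E A s -` B) =
      emeasure (density (distr \<nu> borel (dilation E A s)) (\<lambda>_. k)) B"
    if "sets \<nu> = sets borel" "B \<in> sets borel" for \<nu> B
  proof -
    have "dilation E A s \<in> borel_measurable \<nu>"
      using measurable_dilation[OF s] measurable_cong_sets[OF that(1) refl] by blast
    then show ?thesis
      using that sets_eq_imp_space_eq[OF that(1)] by (simp add: emeasure_density_const emeasure_distr)
  qed
  have "density (distr M borel (dilation E A s)) (\<lambda>_. k) = M"
  proof (rule measure_eqI)
    show "sets (density (distr M borel (dilation E A s)) (\<lambda>_. k)) = sets M" using sets by simp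
    fix B assume "B \<in> sets (density (distr M borel (dilation E A s)) (\<lambda>_. k))"
    then have B: "B \<in> sets borel" by simp
    then have B': "dilation E A s -` B \<in> sets borel"
      using measurable_sets[OF measurable_dilation[OF s] B] by simp
    \<comment> \<open>The factor \<open>e\<close> is nonzero and finite, so it can be cancelled in
      \<open>ennreal\<close> once both sides have been compared through
      \<open>exp_lebesgue\<close>.\<close>
    have "e * (k * emeasure M (dilation E A s -` B)) = emeasure M U * (k * emeasure exp_lebesgue (dilation E A s -` B))"
      using uniq[OF B'] by (metis mult.left_commute)
    also have "\<dots> = emeasure M U * emeasure exp_lebesgue B"
      unfolding scaled[OF sets_exp_lebesgue B] by (simp add: exp_lebesgue_dilation[OF s] k_def)
    also have "\<dots> = e * emeasure M B" using uniq[OF B] by simp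
    finally show "emeasure (density (distr M borel (dilation E A s)) (\<lambda>_. k)) B = emeasure M B"
      using eU unfolding scaled[OF sets B] by (simp add: ennreal_mult_cancel_left)
  qed
  then show ?thesis by (simp add: k_def)
qed

lemma dilation_dilation:
  assumes "s > 0" "t > 0"
  shows "dilation E A s (dilation E A t x) = dilation E A (s * t) x"
proof -
  have "dilation E A s (dilation E A t (E (S w))) = dilation E A (s * t) (E (S w))" for w
    using assms by (simp add: dilation_exp powr_mult mult.assoc del: log_exp)
  from this[of "T (inv E x)"] show ?thesis by simp
qed

lemma dilation_one: "dilation E A 1 x = x"
  using dilation_exp[of 1 "T (inv E x)"] by simp

lemma dilation_zero: "s > 0 \<Longrightarrow> dilation E A s 0 = 0"
  by (simp add: dilation_def alg_dilation_eq linear_0[OF linear_T] zero_vec_def[symmetric] linear_0[OF linear_S])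

text \<open>The points in question form the image of the compact set
  \<open>{a..b} \<times> K\<close> under the jointly continuous map that undoes the dilation. This
  gives one support for all difference quotients in dominated convergence.\<close>

lemma compact_dilated:
  assumes K: "compact K" and a: "0 < a"
  shows "\<exists>K'. compact K' \<and> (\<forall>x s. s \<in> {a..b} \<longrightarrow> dilation E A s x \<in> K \<longrightarrow> x \<in> K')"
proof -
  define g where "g z = E (S (\<chi> i. (1 / fst z) powr \<mu> i * T (inv E (snd z)) $ i))" for z
  have g: "g (s, x) = dilation E A (1 / s) x" if "s > 0" for s x
    using dilation_exp[of "1 / s" "T (inv E x)"] that by (simp add: g_def)
  have "continuous_on ({a..b} \<times> K) g"
    unfolding g_def
    by (rule continuous_on_compose2[OF continuous_exp[of UNIV]])
       (use a in \<open>auto intro!: continuous_intros continuous_on_compose2[OF continuous_log[of UNIV]]\<close>)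
  then have "compact (g ` ({a..b} \<times> K))"
    by (intro compact_continuous_image compact_Times K compact_Icc)
  moreover have "x \<in> g ` ({a..b} \<times> K)" if "s \<in> {a..b}" "dilation E A s x \<in> K" for x s
  proof (rule image_eqI[of _ _ "(s, dilation E A s x)"])
    show "x = g (s, dilation E A s x)"
      using that a by (simp add: g dilation_dilation dilation_one)
  qed (use that in auto)
  ultimately show ?thesis by blast
qed

lemma integrable_compact_support:
  fixes g :: "'g \<Rightarrow> real"
  assumes M: "haar_measure M" and g: "g \<in> borel_measurable borel" and K: "compact K"
    and bd: "\<And>x. \<bar>g x\<bar> \<le> C" and zero: "\<And>x. x \<notin> K \<Longrightarrow> g x = 0"
  shows "integrable M g"
proof (rule Bochner_Integration.integrable_bound)
  have sets: "sets M = sets borel" and fin: "emeasure M K < \<infinity>"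
    using M K by (auto simp: haar_measure_def)
  have "K \<in> sets M" using K sets by (simp add: borel_closed compact_imp_closed)
  then show "integrable M (\<lambda>x. C * indicator K x)"
    using fin by (intro integrable_mult_right integrable_real_indicator)
  show "g \<in> borel_measurable M" using g measurable_cong_sets[OF sets refl] by blast
  show "AE x in M. norm (g x) \<le> norm (C * indicator K x)"
  proof (rule AE_I2)
    fix x
    show "norm (g x) \<le> norm (C * indicator K x)"
      using bd[of x] zero[of x] by (cases "x \<in> K") auto
  qed
qed

lemma integral_dilation:
  fixes g :: "'g \<Rightarrow> real"
  assumes M: "haar_measure M" and s: "s > 0" and g: "g \<in> borel_measurable borel"
  shows "(LINT x|M. g (dilation E A s x)) = s powr (- homogeneous_dimension A) * (LINT x|M. g x)"
proof -
  define k where "k = s powr homogeneous_dimension A"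
  have sets: "sets M = sets borel" using M by (simp add: haar_measure_def)
  have D: "dilation E A s \<in> borel_measurable M"
    using measurable_dilation[OF s] measurable_cong_sets[OF sets refl] by blast
  have "(LINT x|M. g x) = (LINT x|density (distr M borel (dilation E A s)) (\<lambda>_. ennreal k). g x)"
    by (simp add: haar_measure_dilation[OF M s] k_def)
  also have "\<dots> = k * (LINT x|M. g (dilation E A s x))"
    using g D by (simp add: integral_density integral_distr k_def)
  finally show ?thesis
    using s by (simp add: k_def powr_minus field_simps)
qed

lemma difference_quotient_tendsto:
  fixes \<phi> :: "real \<Rightarrow> real"
  assumes "(\<phi> has_real_derivative d) (at 1)"
  shows "(\<lambda>n. real (Suc n) * (\<phi> (1 + 1 / real (Suc n)) - \<phi> 1)) \<longlonglongrightarrow> d"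
proof -
  have "filterlim (\<lambda>n. 1 / real (Suc n)) (at 0) sequentially"
    using LIMSEQ_inverse_real_of_nat by (auto simp: filterlim_at inverse_eq_divide)
  moreover have "((\<lambda>h. (\<phi> (1 + h) - \<phi> 1) / h) \<longlongrightarrow> d) (at 0)"
    using assms by (simp add: DERIV_def)
  ultimately have "(\<lambda>n. (\<phi> (1 + 1 / real (Suc n)) - \<phi> 1) / (1 / real (Suc n))) \<longlonglongrightarrow> d"
    by (rule filterlim_compose[rotated])
  then show ?thesis by (simp add: mult.commute)
qed

text \<open>Obtained by differentiating \<open>\<integral> g (s x) dx = s\<^sup>-\<^sup>Q \<integral> g\<close> at \<open>s = 1\<close>: it replaces
  polar coordinates.\<close>

lemma integral_euler_derivative:
  fixes g h :: "'g \<Rightarrow> real"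
  assumes M: "haar_measure M" and g: "g \<in> borel_measurable borel"
    and deriv: "\<And>x s. s > 0 \<Longrightarrow>
        ((\<lambda>s. g (dilation E A s x)) has_real_derivative h (dilation E A s x) / s) (at s)"
    and K: "compact K" and zero: "\<And>x. x \<notin> K \<Longrightarrow> g x = 0"
    and gC: "\<And>x. \<bar>g x\<bar> \<le> C" and hC: "\<And>x. \<bar>h x\<bar> \<le> C"
  shows "h \<in> borel_measurable borel"
    and "(LINT x|M. h x) = - homogeneous_dimension A * (LINT x|M. g x)"
proof -
  define q where "q n x = real (Suc n) * (g (dilation E A (1 + 1 / real (Suc n)) x) - g x)" for n x
  have sets: "sets M = sets borel" using M by (simp add: haar_measure_def)
  have borel_M: "\<phi> \<in> borel_measurable M" if "\<phi> \<in> borel_measurable borel" for \<phi> :: "'g \<Rightarrow> real"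
    using that measurable_cong_sets[OF sets refl] by blast
  \<comment> \<open>All the scales \<open>1 + 1 / real (Suc n)\<close> lie in
    \<open>{1..2}\<close>.\<close>
  obtain K' where K': "compact K'" "\<And>x s. s \<in> {1..2} \<Longrightarrow> dilation E A s x \<in> K \<Longrightarrow> x \<in> K'"
    using compact_dilated[OF K, of 1 2] by auto
  have s: "1 + 1 / real (Suc n) \<in> {1..2}" "1 + 1 / real (Suc n) > 0" for n by (auto simp: field_simps)
  note gs = measurable_compose[OF measurable_dilation[OF s(2)] g]
  have q_meas: "q n \<in> borel_measurable borel" for n
    unfolding q_def[abs_def] using g gs by measurable
  have lim: "(\<lambda>n. q n x) \<longlonglongrightarrow> h x" for x
    using difference_quotient_tendsto[OF deriv[of 1 x, simplified]]
    by (simp add: q_def dilation_one)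
  show "h \<in> borel_measurable borel"
    using borel_measurable_LIMSEQ_real[OF lim q_meas] by simp
  then have hM: "h \<in> borel_measurable M" by (rule borel_M)
  \<comment> \<open>By the mean value theorem the quotient equals
    \<open>h (dilation E A z x) / z\<close> for some \<open>z > 1\<close>; off \<open>K'\<close>
    both of its terms vanish.\<close>
  have bd: "\<bar>q n x\<bar> \<le> C * indicator K' x" for n x
  proof (cases "x \<in> K'")
    case True
    define t where "t = 1 + 1 / real (Suc n)"
    have "t > 1" by (simp add: t_def)
    then obtain z where z: "1 < z" "z < t"
      "g (dilation E A t x) - g (dilation E A 1 x) = (t - 1) * (h (dilation E A z x) / z)"
      using MVT2[OF \<open>t > 1\<close>, of "\<lambda>s. g (dilation E A s x)" "\<lambda>s. h (dilation E A s x) / s"] deriv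
      by auto
    then have "q n x = h (dilation E A z x) / z"
      by (simp add: q_def t_def[symmetric] dilation_one) (simp add: t_def)
    then have "\<bar>q n x\<bar> = \<bar>h (dilation E A z x)\<bar> / z" using z by simp
    also have "\<dots> \<le> \<bar>h (dilation E A z x)\<bar> / 1" using z by (intro divide_left_mono) auto
    finally show ?thesis using hC[of "dilation E A z x"] True by simp
  next
    case False
    then have "dilation E A (1 + 1 / real (Suc n)) x \<notin> K" "x \<notin> K"
      using K'(2)[OF s(1)] K'(2)[of 1 x] dilation_one by auto
    then show ?thesis using False by (simp add: q_def zero)
  qed
  have int_bd: "integrable M (\<lambda>x. C * indicator K' x)"
  proof -
    have "K' \<in> sets M" "emeasure M K' < \<infinity>"
      using K'(1) M sets by (auto simp: haar_measure_def borel_closed compact_imp_closed)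
    then show ?thesis by (intro integrable_mult_right integrable_real_indicator)
  qed
  have "(\<lambda>n. LINT x|M. q n x) \<longlonglongrightarrow> (LINT x|M. h x)"
    by (rule integral_dominated_convergence[OF hM borel_M[OF q_meas] int_bd])
       (auto intro: lim bd)
  \<comment> \<open>By \<open>integral_dilation\<close> the integrated quotient is a multiple of the
    difference quotient at 1 of \<open>s powr (- Q)\<close>, whose derivative there is
    \<open>- Q\<close>.\<close>
  moreover have "(LINT x|M. q n x) = (LINT x|M. g x) *
      (real (Suc n) * ((1 + 1 / real (Suc n)) powr (- homogeneous_dimension A) - 1 powr (- homogeneous_dimension A)))" for n
  proof -
    have 1: "integrable M g" by (rule integrable_compact_support[OF M g K gC zero])
    have 2: "integrable M (\<lambda>x. g (dilation E A (1 + 1 / real (Suc n)) x))"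
      by (rule integrable_compact_support[OF M gs K'(1) gC]) (use K'(2)[OF s(1)] zero in blast)
    have "(LINT x|M. q n x) = real (Suc n) * ((LINT x|M. g (dilation E A (1 + 1 / real (Suc n)) x)) - (LINT x|M. g x))"
      unfolding q_def using 1 2 by simp
    then show ?thesis
      unfolding integral_dilation[OF M s(2) g] by (simp add: algebra_simps)
  qed
  moreover have "(\<lambda>n. (LINT x|M. g x) * (real (Suc n) *
      ((1 + 1 / real (Suc n)) powr (- homogeneous_dimension A) - 1 powr (- homogeneous_dimension A))))
      \<longlonglongrightarrow> (LINT x|M. g x) * (- homogeneous_dimension A)"
    by (intro tendsto_mult_left difference_quotient_tendsto)
       (auto intro!: derivative_eq_intros)
  ultimately show "(LINT x|M. h x) = - homogeneous_dimension A * (LINT x|M. g x)"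
    using LIMSEQ_unique by (fastforce simp: mult.commute)
qed

end

subsection \<open>The critical Hardy inequality\<close>

text \<open>Covers the zeros of \<open>f\<close>: as \<open>q > 1\<close>, the remainder at the
  origin is \<open>norm h powr (q - 1)\<close>, which tends to 0, and the formula gives 0 there
  because the inner product vanishes.\<close>

lemma has_derivative_norm_powr:
  fixes z :: "'a::real_inner"
  assumes "q > 1"
  shows "((\<lambda>z. norm z powr q) has_derivative (\<lambda>w. q * norm z powr (q - 2) * (z \<bullet> w))) (at z)"
proof (cases "z = 0")
  case True
  have "((\<lambda>h::'a. norm h powr (q - 1)) \<longlongrightarrow> 0 powr (q - 1)) (at 0)"
    using assms by (intro tendsto_powr2 tendsto_norm_zero tendsto_ident_at tendsto_const) auto
  then have "((\<lambda>h::'a. norm h powr (q - 1)) \<longlongrightarrow> 0) (at 0)" using assms by simp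
  then have "((\<lambda>h::'a. norm (norm (0 + h) powr q - norm (0::'a) powr q - 0) / norm h) \<longlongrightarrow> 0) (at 0)"
    by (rule Lim_transform_eventually) (auto simp: eventually_at_filter powr_diff)
  then show ?thesis using True by (simp add: has_derivative_at bounded_linear_zero)
next
  case False
  have "((\<lambda>z. norm z powr q) has_derivative (\<lambda>w. (sgn z \<bullet> w) * (q * norm z powr (q - 1)))) (at z)"
    using has_derivative_compose[OF has_derivative_norm[OF False],
        OF has_real_derivative_powr[THEN has_field_derivative_imp_has_derivative], of q] False
    by (simp add: inner_commute mult_ac)
  moreover have "(sgn z \<bullet> w) * (q * norm z powr (q - 1)) = q * norm z powr (q - 2) * (z \<bullet> w)" for w
  proof -
    have "norm z powr (q - 1) = norm z powr (q - 2) * norm z"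
      using powr_mult_base[of "norm z" "q - 2"] by (simp add: mult.commute)
    then show ?thesis using False by (simp add: sgn_div_norm)
  qed
  ultimately show ?thesis by simp
qed

text \<open>Young's inequality for both functions divided by their norms, then integrated. If a norm
  is 0, the product vanishes almost everywhere.\<close>

lemma Holder_inequality:
  fixes u v :: "'a \<Rightarrow> real"
  assumes pq: "p > 1" "q > 1" "1 / p + 1 / q = 1"
    and nonneg: "\<And>x. u x \<ge> 0" "\<And>x. v x \<ge> 0"
    and int: "integrable M (\<lambda>x. u x powr p)" "integrable M (\<lambda>x. v x powr q)" "integrable M (\<lambda>x. u x * v x)"
  shows "(LINT x|M. u x * v x) \<le> (LINT x|M. u x powr p) powr (1 / p) * (LINT x|M. v x powr q) powr (1 / q)"
proof -
  define X where "X = (LINT x|M. u x powr p)"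
  define Y where "Y = (LINT x|M. v x powr q)"
  have "X \<ge> 0" "Y \<ge> 0" by (auto simp: X_def Y_def)
  show ?thesis
  proof (cases "X = 0 \<or> Y = 0")
    case True
    then have "AE x in M. u x * v x = 0"
    proof
      assume "X = 0"
      then have "AE x in M. u x powr p = 0"
        using integral_nonneg_eq_0_iff_AE[OF int(1)] by (simp add: X_def)
      then show ?thesis by eventually_elim simp
    next
      assume "Y = 0"
      then have "AE x in M. v x powr q = 0"
        using integral_nonneg_eq_0_iff_AE[OF int(2)] by (simp add: Y_def)
      then show ?thesis by eventually_elim simp
    qed
    then have "(LINT x|M. u x * v x) = 0" by (rule integral_eq_zero_AE)
    then show ?thesis by simp
  next
    case False
    with \<open>X \<ge> 0\<close> \<open>Y \<ge> 0\<close> have XY: "X > 0" "Y > 0" by auto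
    define c where "c = X powr (1 / p) * Y powr (1 / q)"
    have "c > 0" using XY by (simp add: c_def)
    have pw: "u x * v x / c \<le> u x powr p / (p * X) + v x powr q / (q * Y)" for x
    proof -
      have "u x * v x / c = (u x / X powr (1 / p)) * (v x / Y powr (1 / q))" by (simp add: c_def)
      also have "\<dots> \<le> (u x / X powr (1 / p)) powr p / p + (v x / Y powr (1 / q)) powr q / q"
        using nonneg XY by (intro Youngs_inequality pq) auto
      also have "\<dots> = u x powr p / (p * X) + v x powr q / (q * Y)"
        using nonneg XY pq by (simp add: powr_divide powr_powr mult.commute)
      finally show ?thesis .
    qed
    have "(LINT x|M. u x * v x) / c = (LINT x|M. u x * v x / c)" by simp
    also have "\<dots> \<le> (LINT x|M. u x powr p / (p * X) + v x powr q / (q * Y))"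
      using int pw by (intro integral_mono) auto
    also have "\<dots> = X / (p * X) + Y / (q * Y)"
      using int by (simp add: X_def Y_def)
    also have "\<dots> = 1" using XY pq by simp
    finally show ?thesis using \<open>c > 0\<close> by (simp add: c_def X_def Y_def field_simps)
  qed
qed

section \<open>The Euler operator along dilation orbits\<close>

context graded_coordinates
begin

text \<open>The Euler operator \<open>|x| \<R>\<close>, which does not depend on the quasi-norm.\<close>

definition euler :: "('g \<Rightarrow> complex) \<Rightarrow> 'g \<Rightarrow> complex" where
  "euler f x = frechet_derivative (\<lambda>v. f (E v)) (at (inv E x)) (A (inv E x))"

lemma S_expansion: "S w = (\<Sum>i\<in>UNIV. w $ i *\<^sub>R S (axis i 1))"
  by (subst basis_expansion[symmetric, of w])
     (simp add: scalar_mult_eq_scaleR linear_sum[OF linear_S] linear_cmul[OF linear_S])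

text \<open>In eigencoordinates the orbit has components \<open>r powr \<mu> i * w $ i\<close>, so
  its velocity at \<open>s\<close> is \<open>A\<close> applied to its position, divided by
  \<open>s\<close>.\<close>

lemma euler_derivative:
  assumes f: "smooth_fun \<A> f" and s: "s > 0"
  shows "((\<lambda>r. f (dilation E A r x)) has_vector_derivative (1 / s) *\<^sub>R euler f (dilation E A s x)) (at s)"
proof -
  define w where "w = T (inv E x)"
  define c where "c r = S (\<chi> i. r powr \<mu> i * w $ i)" for r
  have dil: "dilation E A r x = E (c r)" if "r > 0" for r
    using dilation_exp[OF that, of w] by (simp add: c_def w_def)
  have c_sum: "c r = (\<Sum>i\<in>UNIV. (r powr \<mu> i * w $ i) *\<^sub>R S (axis i 1))" for r
    unfolding c_def by (subst S_expansion) simp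
  have "(c has_derivative (\<lambda>h. \<Sum>i\<in>UNIV. (h * (\<mu> i * s powr (\<mu> i - 1) * w $ i)) *\<^sub>R S (axis i 1))) (at s)"
    unfolding c_sum[abs_def] using s
    by (auto intro!: derivative_eq_intros has_derivative_scaleR_left simp: fun_eq_iff field_simps powr_diff sum_distrib_left)
  also have "(\<lambda>h. \<Sum>i\<in>UNIV. (h * (\<mu> i * s powr (\<mu> i - 1) * w $ i)) *\<^sub>R S (axis i 1)) = (\<lambda>h. (h / s) *\<^sub>R A (c s))"
  proof
    fix h
    have "A (c s) = (\<Sum>i\<in>UNIV. (\<mu> i * (s powr \<mu> i * w $ i)) *\<^sub>R S (axis i 1))"
      unfolding c_def A_S by (subst S_expansion) simp
    then show "(\<Sum>i\<in>UNIV. (h * (\<mu> i * s powr (\<mu> i - 1) * w $ i)) *\<^sub>R S (axis i 1)) = (h / s) *\<^sub>R A (c s)"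
      using s by (simp add: scaleR_sum_right powr_diff field_simps)
  qed
  finally have c': "(c has_derivative (\<lambda>h. (h / s) *\<^sub>R A (c s))) (at s)" .
  define F' where "F' = frechet_derivative (\<lambda>v. f (E v)) (at (c s))"
  have F': "((\<lambda>v. f (E v)) has_derivative F') (at (c s))"
    unfolding F'_def using smooth_on_has_derivative[OF smooth_exp_comp[OF f]] by simp
  have lin: "linear F'" using F' has_derivative_linear by blast
  have "((\<lambda>r. f (E (c r))) has_derivative (\<lambda>h. F' ((h / s) *\<^sub>R A (c s)))) (at s)"
    using c' F' by (rule has_derivative_compose)
  also have "(\<lambda>h. F' ((h / s) *\<^sub>R A (c s))) = (\<lambda>h. h *\<^sub>R ((1 / s) *\<^sub>R euler f (dilation E A s x)))"
    unfolding dil[OF s] euler_def by (simp add: linear_cmul[OF lin] flip: F'_def)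
  finally have "((\<lambda>r. f (E (c r))) has_vector_derivative (1 / s) *\<^sub>R euler f (dilation E A s x)) (at s)"
    by (simp only: has_vector_derivative_def)
  then show ?thesis
    by (rule has_vector_derivative_transform_within_open[of _ _ _ "{0<..}"]) (use s dil in auto)
qed

lemma continuous_euler:
  assumes f: "smooth_fun \<A> f"
  shows "continuous_on UNIV (euler f)"
proof -
  define F where "F = (\<lambda>v. f (E v))"
  have F: "smooth_on UNIV F" unfolding F_def by (rule smooth_exp_comp[OF f])
  have lin: "linear (frechet_derivative F (at v))" for v
    using smooth_on_has_derivative[OF F] has_derivative_linear by blast
  have eq: "frechet_derivative F (at v) (A v) = (\<Sum>b\<in>Basis. (A v \<bullet> b) *\<^sub>R frechet_derivative F (at v) b)" for v
    by (subst euclidean_representation[symmetric, of "A v"])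
       (simp only: linear_sum[OF lin] linear_cmul[OF lin])
  have "continuous_on UNIV A" using linear_A by (simp add: linear_continuous_on linear_conv_bounded_linear)
  then have "continuous_on UNIV (\<lambda>v. frechet_derivative F (at v) (A v))"
    unfolding eq by (intro continuous_intros smooth_on_continuous_on[OF smooth_on_frechet_derivative[OF F]])
  from continuous_on_compose2[OF this smooth_map_continuous[OF log_smooth]]
  show ?thesis by (simp add: euler_def[abs_def] F_def)
qed

lemma euler_zero:
  assumes f: "smooth_fun \<A> f" and V: "open V" "x \<in> V" "\<And>y. y \<in> V \<Longrightarrow> f y = 0"
  shows "euler f x = 0"
proof -
  have "open (E -` V)" using V(1) smooth_map_continuous[OF exp_smooth] by (intro open_vimage)
  moreover have "((\<lambda>v. 0) has_derivative (\<lambda>_. 0)) (at (inv E x))" by simp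
  ultimately have "((\<lambda>v. f (E v)) has_derivative (\<lambda>_. 0)) (at (inv E x))"
    using has_derivative_transform_within_open[of "\<lambda>v. 0" "\<lambda>_. 0" "inv E x" UNIV "E -` V" "\<lambda>v. f (E v)"] V
    by simp
  from fun_cong[OF frechet_derivative_at[OF this], of "A (inv E x)"] show ?thesis by (simp add: euler_def)
qed

end

text \<open>The ball is replaced by a compact set \<open>K\<close> outside of which \<open>f\<close>
  vanishes. Since \<open>K\<close> avoids the unit, \<open>N\<close> is positive on it, and negative
  powers and the logarithm of \<open>N\<close> are continuous there.\<close>

locale test_function_coordinates = graded_coordinates \<A> L E A T S \<mu>
  for \<A> :: "('g::{topological_group_add, t2_space, second_countable_topology},
             'v::euclidean_space) atlas"
    and L E A T S \<mu> +
  fixes M :: "'g measure" and N :: "'g \<Rightarrow> real" and f :: "'g \<Rightarrow> complex" and K :: "'g set" and Q :: real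
  assumes M: "haar_measure M" and N: "homogeneous_quasi_norm E A N"
    and f: "smooth_fun \<A> f" and K: "compact K" and f_zero: "\<And>x. x \<notin> K \<Longrightarrow> f x = 0"
    and zero_K: "0 \<notin> K" and Q: "Q = homogeneous_dimension A" "Q \<ge> 2"
begin

lemma N_pos: "x \<noteq> 0 \<Longrightarrow> N x > 0"
  and N_dilation: "s > 0 \<Longrightarrow> N (dilation E A s x) = s * N x"
  and N_nonneg: "N x \<ge> 0"
  using N unfolding homogeneous_quasi_norm_def by (auto simp: less_le)

lemma continuous_N: "continuous_on X N"
  using N continuous_on_subset unfolding homogeneous_quasi_norm_def by blast

lemma N_pos_K: "x \<in> K \<Longrightarrow> N x > 0"
  using N_pos zero_K by metis

lemma continuous_f: "continuous_on X f"
  using smooth_map_continuous[OF f] continuous_on_subset by blast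

lemma continuous_euler_f: "continuous_on X (euler f)"
  using continuous_euler[OF f] continuous_on_subset by blast

lemma euler_zero_K: "x \<notin> K \<Longrightarrow> euler f x = 0"
  using euler_zero[OF f, of "- K" x] K f_zero by (auto simp: open_Compl compact_imp_closed)

lemma bounded_K:
  fixes \<phi> :: "'g \<Rightarrow> real"
  assumes "continuous_on K \<phi>" "\<And>x. x \<notin> K \<Longrightarrow> \<phi> x = 0"
  shows "\<exists>C. \<forall>x. \<bar>\<phi> x\<bar> \<le> C"
proof -
  have "bounded (\<phi> ` K)" using assms(1) K by (intro compact_imp_bounded compact_continuous_image)
  then obtain C where C: "\<forall>x\<in>K. \<bar>\<phi> x\<bar> \<le> C" by (auto simp: bounded_iff)
  then have "\<bar>\<phi> x\<bar> \<le> max C 0" for x by (cases "x \<in> K") (auto simp: assms(2) max_def)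
  then show ?thesis by blast
qed

lemma measurable_K:
  fixes \<phi> :: "'g \<Rightarrow> real"
  assumes "continuous_on K \<phi>" "\<And>x. x \<notin> K \<Longrightarrow> \<phi> x = 0"
  shows "\<phi> \<in> borel_measurable borel"
proof -
  have "K \<in> sets borel" using K by (simp add: borel_closed compact_imp_closed)
  then have "(\<lambda>x. indicator K x *\<^sub>R \<phi> x) \<in> borel_measurable borel"
    using assms(1) by (rule borel_measurable_continuous_on_indicator)
  also have "(\<lambda>x. indicator K x *\<^sub>R \<phi> x) = \<phi>" using assms(2) by (auto simp: fun_eq_iff indicator_def)
  finally show ?thesis .
qed

lemma integrable_K:
  fixes \<phi> :: "'g \<Rightarrow> real"
  assumes "continuous_on K \<phi>" "\<And>x. x \<notin> K \<Longrightarrow> \<phi> x = 0"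
  shows "integrable M \<phi>"
  using bounded_K[OF assms] integrable_compact_support[OF M measurable_K[OF assms] K] assms(2) by blast

text \<open>The orbit of the normalised point passes through \<open>x\<close> at parameter
  \<open>N x\<close>, and \<open>euler_derivative\<close> brings in the reciprocal of that
  parameter.\<close>

lemma radial_deriv_eq:
  assumes "N x > 0"
  shows "radial_deriv E A N f x = (1 / N x) *\<^sub>R euler f x"
proof -
  have "dilation E A (N x) (dilation E A (1 / N x) x) = x"
    using assms by (simp add: dilation_dilation dilation_one)
  then show ?thesis
    using vector_derivative_at[OF euler_derivative[OF f assms, of "dilation E A (1 / N x) x"]]
    by (simp add: radial_deriv_def)
qed

text \<open>\<open>ratio\<close> and \<open>slope\<close> are the functions whose
  \<open>Q\<close>-norms the Hardy inequality compares; by \<open>radial_deriv_eq\<close>,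
  \<open>slope\<close> is the modulus of \<open>ln (N x)\<close> times the radial
  derivative.\<close>

definition ratio :: "'g \<Rightarrow> real" where "ratio x = cmod (f x) / N x"
definition slope :: "'g \<Rightarrow> real" where "slope x = \<bar>ln (N x)\<bar> * cmod (euler f x) / N x"

lemma continuous_ratio: "continuous_on K ratio"
  unfolding ratio_def[abs_def] using N_pos_K by (intro continuous_intros continuous_N continuous_f) force

lemma continuous_slope: "continuous_on K slope"
  unfolding slope_def[abs_def] using N_pos_K
  by (intro continuous_intros continuous_N continuous_euler_f) force+

lemma ratio_nonneg: "ratio x \<ge> 0" and slope_nonneg: "slope x \<ge> 0"
  using N_nonneg by (auto simp: ratio_def slope_def)

lemma ratio_zero: "x \<notin> K \<Longrightarrow> ratio x = 0" and slope_zero: "x \<notin> K \<Longrightarrow> slope x = 0"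
  by (auto simp: ratio_def slope_def f_zero euler_zero_K)

lemma integral_ratio_le:
  "(LINT x|M. ratio x powr Q) \<le> Q * (LINT x|M. slope x * ratio x powr (Q - 1))"
proof -
  define g where "g x = cmod (f x) powr Q * (N x powr (- Q) * ln (N x))" for x
  \<comment> \<open>The two halves of the product rule for the Euler derivative of \<open>g\<close>:
    \<open>h1\<close> differentiates the power of \<open>f\<close>, \<open>h2\<close> the weight,
    where \<open>N\<close> is its own Euler derivative.\<close>
  define h1 where "h1 x = Q * cmod (f x) powr (Q - 2) * (f x \<bullet> euler f x) * (N x powr (- Q) * ln (N x))" for x
  define h2 where "h2 x = cmod (f x) powr Q * (N x powr (- Q) * (1 - Q * ln (N x)))" for x
  have g_K: "continuous_on K g"
    unfolding g_def[abs_def] using N_pos_K Q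
    by (intro continuous_intros continuous_on_powr' continuous_N continuous_f) (force | simp)+
  have g0: "g x = 0" if "x \<notin> K" for x using that by (simp add: g_def f_zero)
  have h2_K: "continuous_on K h2"
    unfolding h2_def[abs_def] using N_pos_K Q
    by (intro continuous_intros continuous_on_powr' continuous_N continuous_f) (force | simp)+
  have h20: "h2 x = 0" if "x \<notin> K" for x using that by (simp add: h2_def f_zero)
  have r_K: "continuous_on K (\<lambda>x. slope x * ratio x powr (Q - 1))"
    using Q ratio_nonneg by (intro continuous_intros continuous_on_powr' continuous_slope continuous_ratio) auto
  have r0: "slope x * ratio x powr (Q - 1) = 0" if "x \<notin> K" for x using that by (simp add: slope_zero)
  have p_K: "continuous_on K (\<lambda>x. ratio x powr Q)"
    using Q ratio_nonneg by (intro continuous_intros continuous_on_powr' continuous_ratio) auto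
  have p0: "ratio x powr Q = 0" if "x \<notin> K" for x using that by (simp add: ratio_zero)
  \<comment> \<open>Besides being the main estimate, this bounds \<open>h1\<close> without
    continuity of its factors: for \<open>Q = 2\<close> the factor
    \<open>cmod (f x) powr (Q - 2)\<close> jumps to 0 at the zeros of \<open>f\<close>, as
    \<open>0 powr 0 = 0\<close>.\<close>
  have h1_le: "\<bar>h1 x\<bar> \<le> Q * (slope x * ratio x powr (Q - 1))" for x
  proof (cases "x \<in> K")
    case True
    define c where "c = cmod (f x)"
    have n: "N x > 0" using N_pos_K[OF True] .
    have c: "c powr (Q - 2) * c = c powr (Q - 1)"
      using powr_mult_base[of c "Q - 2"] by (simp add: c_def mult.commute)
    have "\<bar>h1 x\<bar> = Q * (c powr (Q - 2) * \<bar>f x \<bullet> euler f x\<bar> * (N x powr (- Q) * \<bar>ln (N x)\<bar>))"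
      using Q by (simp add: h1_def abs_mult c_def)
    also have "\<dots> \<le> Q * (c powr (Q - 2) * (c * cmod (euler f x)) * (N x powr (- Q) * \<bar>ln (N x)\<bar>))"
      using Q unfolding c_def
      by (intro mult_left_mono mult_right_mono Cauchy_Schwarz_ineq2) auto
    also have "\<dots> = Q * (c powr (Q - 1) * cmod (euler f x) * (N x powr (- Q) * \<bar>ln (N x)\<bar>))"
      by (simp add: c[symmetric])
    also have "\<dots> = Q * (slope x * ratio x powr (Q - 1))"
      using n by (simp add: slope_def ratio_def c_def[symmetric] powr_divide powr_diff powr_minus field_simps)
    finally show ?thesis .
  qed (simp add: h1_def f_zero slope_zero)
  obtain C1 where C1: "\<And>x. \<bar>g x\<bar> \<le> C1" using bounded_K[OF g_K g0] by blast
  obtain C2 where C2: "\<And>x. \<bar>h2 x\<bar> \<le> C2" using bounded_K[OF h2_K h20] by blast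
  obtain C3 where C3: "\<And>x. \<bar>slope x * ratio x powr (Q - 1)\<bar> \<le> C3" using bounded_K[OF r_K r0] by blast
  define C where "C = max C1 (Q * C3 + C2)"
  have gC: "\<bar>g x\<bar> \<le> C" for x using C1[of x] by (simp add: C_def)
  have hC: "\<bar>h1 x + h2 x\<bar> \<le> C" for x
  proof -
    have "slope x * ratio x powr (Q - 1) \<le> C3" using C3[of x] by simp
    then have "Q * (slope x * ratio x powr (Q - 1)) \<le> Q * C3" using Q by (intro mult_left_mono) auto
    then show ?thesis using h1_le[of x] C2[of x] by (simp add: C_def)
  qed
  have deriv: "((\<lambda>s. g (dilation E A s x)) has_real_derivative
      (h1 (dilation E A s x) + h2 (dilation E A s x)) / s) (at s)" if s: "s > 0" for x s
  proof (cases "x = 0")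
    \<comment> \<open>The unit is fixed by all dilations and lies outside \<open>K\<close>, so the
      function of \<open>s\<close> is constantly 0; the other case relies on
      \<open>N x > 0\<close>.\<close>
    case True
    have "((\<lambda>s. g (dilation E A s x)) has_real_derivative 0) (at s)"
      by (rule has_field_derivative_transform_within_open[of "\<lambda>_. 0" _ _ "{0<..}"])
         (use s True zero_K in \<open>auto simp: dilation_zero g0\<close>)
    moreover have "h1 0 = 0" "h2 0 = 0" using zero_K f_zero by (auto simp: h1_def h2_def)
    ultimately show ?thesis using True s by (simp add: dilation_zero)
  next
    case False
    define y where "y = dilation E A s x"
    have n: "N x > 0" using False by (rule N_pos)
    have Ny: "N y = s * N x" using s by (simp add: y_def N_dilation)
    have F: "((\<lambda>s. f (dilation E A s x)) has_derivative (\<lambda>h. h *\<^sub>R ((1 / s) *\<^sub>R euler f y))) (at s)"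
      using euler_derivative[OF f s, of x] by (simp add: has_vector_derivative_def y_def)
    have "((\<lambda>s. cmod (f (dilation E A s x)) powr Q) has_derivative
        (\<lambda>h. Q * cmod (f y) powr (Q - 2) * (f y \<bullet> (h *\<^sub>R ((1 / s) *\<^sub>R euler f y))))) (at s)"
      using has_derivative_compose[OF F has_derivative_norm_powr[of Q "f (dilation E A s x)"]] Q
      by (simp add: y_def)
    also have "(\<lambda>h. Q * cmod (f y) powr (Q - 2) * (f y \<bullet> (h *\<^sub>R ((1 / s) *\<^sub>R euler f y)))) =
        (*) (Q * cmod (f y) powr (Q - 2) * (f y \<bullet> euler f y) / s)"
      by (simp add: fun_eq_iff)
    finally have 1: "((\<lambda>s. cmod (f (dilation E A s x)) powr Q) has_real_derivative
        Q * cmod (f y) powr (Q - 2) * (f y \<bullet> euler f y) / s) (at s)"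
      unfolding has_field_derivative_def .
    have 2: "((\<lambda>s. (s * N x) powr (- Q) * ln (s * N x)) has_real_derivative
        N y powr (- Q) * (1 - Q * ln (N y)) / s) (at s)"
      unfolding Ny using s n
      by (auto intro!: derivative_eq_intros simp: powr_diff field_simps)
    have "((\<lambda>s. cmod (f (dilation E A s x)) powr Q * ((s * N x) powr (- Q) * ln (s * N x)))
        has_real_derivative (h1 y + h2 y) / s) (at s)"
      by (rule DERIV_cong[OF DERIV_mult[OF 1 2]])
         (use s in \<open>simp add: y_def[symmetric] Ny[symmetric] h1_def h2_def field_simps\<close>)
    then have "((\<lambda>s. g (dilation E A s x)) has_real_derivative (h1 y + h2 y) / s) (at s)"
      by (rule has_field_derivative_transform_within_open[of _ _ _ "{0<..}"])
         (use s in \<open>auto simp: g_def N_dilation\<close>)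
    then show ?thesis by (simp add: y_def)
  qed
  note euler = integral_euler_derivative[OF M measurable_K[OF g_K g0] deriv K g0 gC hC]
  have h_int: "integrable M (\<lambda>x. h1 x + h2 x)"
    by (rule integrable_compact_support[OF M euler(1) K hC]) (simp_all add: h1_def h20 f_zero)
  \<comment> \<open>\<open>h2 + Q * g\<close> is exactly the left side, and \<open>h1\<close> is
    absorbed by \<open>h1_le\<close>. The sum \<open>h1 + h2\<close> is kept together because its
    integral cancels that of \<open>Q * g\<close>.\<close>
  have "ratio x powr Q \<le> (h1 x + h2 x) + Q * g x + Q * (slope x * ratio x powr (Q - 1))" for x
  proof -
    have "h2 x + Q * g x = cmod (f x) powr Q * N x powr (- Q)"
      by (simp add: h2_def g_def algebra_simps)
    also have "\<dots> = ratio x powr Q"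
      using N_nonneg by (simp add: ratio_def powr_divide powr_minus field_simps)
    finally show ?thesis using h1_le[of x] by linarith
  qed
  then have "(LINT x|M. ratio x powr Q) \<le>
      (LINT x|M. (h1 x + h2 x) + Q * g x + Q * (slope x * ratio x powr (Q - 1)))"
    using h_int integrable_K[OF g_K g0] integrable_K[OF r_K r0] integrable_K[OF p_K p0]
    by (intro integral_mono) auto
  also have "\<dots> = (LINT x|M. h1 x + h2 x) + Q * (LINT x|M. g x) + Q * (LINT x|M. slope x * ratio x powr (Q - 1))"
    using h_int integrable_K[OF g_K g0] integrable_K[OF r_K r0] by simp
  also have "\<dots> = Q * (LINT x|M. slope x * ratio x powr (Q - 1))"
    using euler(2) Q(1) by simp
  finally show ?thesis .
qed

text \<open>Hoelder's inequality with exponents \<open>Q\<close> and \<open>Q / (Q - 1)\<close>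
  reproduces the integral \<open>I\<close> of \<open>ratio x powr Q\<close> on the right, to the
  smaller power \<open>1 - 1 / Q\<close>, which is then divided out.\<close>

lemma critical_Hardy_inequality:
  "(LINT x|M. ratio x powr Q) powr (1 / Q) \<le> Q * (LINT x|M. slope x powr Q) powr (1 / Q)"
proof -
  define I where "I = (LINT x|M. ratio x powr Q)"
  define B where "B = (LINT x|M. slope x powr Q)"
  have "I \<ge> 0" by (simp add: I_def)
  have q: "(ratio x powr (Q - 1)) powr (Q / (Q - 1)) = ratio x powr Q" for x
    using Q by (simp add: powr_powr)
  have "(LINT x|M. slope x * ratio x powr (Q - 1)) \<le>
      (LINT x|M. slope x powr Q) powr (1 / Q) *
      (LINT x|M. (ratio x powr (Q - 1)) powr (Q / (Q - 1))) powr (1 / (Q / (Q - 1)))"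
  proof (rule Holder_inequality)
    show "integrable M (\<lambda>x. (ratio x powr (Q - 1)) powr (Q / (Q - 1)))" unfolding q
      using Q ratio_nonneg
      by (intro integrable_K continuous_intros continuous_on_powr' continuous_ratio) (auto simp: ratio_zero)
    show "integrable M (\<lambda>x. slope x powr Q)"
      using Q slope_nonneg
      by (intro integrable_K continuous_intros continuous_on_powr' continuous_slope) (auto simp: slope_zero)
    show "integrable M (\<lambda>x. slope x * ratio x powr (Q - 1))"
      using Q ratio_nonneg
      by (intro integrable_K continuous_intros continuous_on_powr' continuous_slope continuous_ratio)
         (auto simp: slope_zero)
  qed (use Q slope_nonneg in \<open>auto simp: field_simps\<close>)
  then have "(LINT x|M. slope x * ratio x powr (Q - 1)) \<le> B powr (1 / Q) * I powr (1 - 1 / Q)"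
    using Q unfolding q by (simp add: I_def B_def diff_divide_distrib)
  then have "Q * (LINT x|M. slope x * ratio x powr (Q - 1)) \<le> Q * (B powr (1 / Q) * I powr (1 - 1 / Q))"
    using Q by (intro mult_left_mono) auto
  then have le: "I \<le> Q * B powr (1 / Q) * I powr (1 - 1 / Q)"
    using integral_ratio_le by (simp add: I_def mult.assoc)
  have "I powr (1 / Q) \<le> Q * B powr (1 / Q)"
  proof (cases "I = 0")
    case False
    then have "I > 0" using \<open>I \<ge> 0\<close> by simp
    then have "I powr (1 / Q) * I powr (1 - 1 / Q) = I" by (simp flip: powr_add)
    then have "I powr (1 / Q) * I powr (1 - 1 / Q) \<le> Q * B powr (1 / Q) * I powr (1 - 1 / Q)"
      using le by simp
    then show ?thesis using \<open>I > 0\<close> by simp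
  qed (use Q in simp)
  then show ?thesis by (simp add: I_def B_def)
qed

lemma uncertainty_inequality:
  "(LINT x|M. (cmod (f x))\<^sup>2) \<le> Q * (LINT x|M. slope x powr Q) powr (1 / Q) *
     (LINT x|M. (N x * cmod (f x)) powr (Q / (Q - 1))) powr ((Q - 1) / Q)"
proof -
  \<comment> \<open>Also true at the unit, where \<open>N\<close> is 0 but \<open>f\<close> vanishes
    as well.\<close>
  have eq: "(cmod (f x))\<^sup>2 = ratio x * (N x * cmod (f x))" for x
    using N_pos_K[of x] f_zero[of x] by (cases "x \<in> K") (auto simp: ratio_def power2_eq_square)
  have "(LINT x|M. ratio x * (N x * cmod (f x))) \<le> (LINT x|M. ratio x powr Q) powr (1 / Q) *
      (LINT x|M. (N x * cmod (f x)) powr (Q / (Q - 1))) powr (1 / (Q / (Q - 1)))"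
  proof (rule Holder_inequality)
    show "integrable M (\<lambda>x. ratio x powr Q)"
      using Q ratio_nonneg
      by (intro integrable_K continuous_intros continuous_on_powr' continuous_ratio) (auto simp: ratio_zero)
    show "integrable M (\<lambda>x. (N x * cmod (f x)) powr (Q / (Q - 1)))"
      using Q N_nonneg
      by (intro integrable_K continuous_intros continuous_on_powr' continuous_N continuous_f) (auto simp: f_zero)
    show "integrable M (\<lambda>x. ratio x * (N x * cmod (f x)))"
      by (intro integrable_K continuous_intros continuous_ratio continuous_N continuous_f) (auto simp: f_zero)
  qed (use Q ratio_nonneg N_nonneg in \<open>auto simp: field_simps\<close>)
  also have "\<dots> \<le> Q * (LINT x|M. slope x powr Q) powr (1 / Q) *
      (LINT x|M. (N x * cmod (f x)) powr (Q / (Q - 1))) powr (1 / (Q / (Q - 1)))"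
    by (intro mult_right_mono critical_Hardy_inequality) simp
  finally show ?thesis by (simp add: eq)
qed

end

theorem corollary4p3:
  fixes \<A> :: "('g::{topological_group_add, t2_space, second_countable_topology},
               'v::euclidean_space) atlas"
    and L :: "'v \<Rightarrow> ('g \<Rightarrow> real) \<Rightarrow> ('g \<Rightarrow> real)"
    and E :: "'v \<Rightarrow> 'g" and A :: "'v \<Rightarrow> 'v"
    and M :: "'g measure" and N :: "'g \<Rightarrow> real"
    and Q R :: real and f :: "'g \<Rightarrow> complex"
  assumes "homogeneous_group \<A> L E A"
    and "Q = homogeneous_dimension A" and "Q \<ge> 2"
    and "haar_measure M"
    and "homogeneous_quasi_norm E A N"
    and "R > 0"
    and "test_function \<A> (quasi_ball N R - {0}) f"
  shows "(LINT x:quasi_ball N R|M. cmod (ln (N x) * radial_deriv E A N f x) powr Q) powr (1 / Q) *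
         (LINT x:quasi_ball N R|M. N x powr (Q / (Q - 1)) * cmod (f x) powr (Q / (Q - 1)))
           powr ((Q - 1) / Q)
         \<ge> 1 / Q * (LINT x:quasi_ball N R|M. (cmod (f x))\<^sup>2)"
proof -
  interpret homogeneous_group \<A> L E A by (rule assms(1))
  obtain T S \<mu> where "eigenbasis A T S \<mu>"
    using eigenbasis_exists[OF linear_A diagonalisable_A] by blast
  then interpret eigenbasis A T S \<mu> .
  define K where "K = closure {x. f x \<noteq> 0}"
  have K: "compact K" and K_ball: "K \<subseteq> quasi_ball N R - {0}" and f: "smooth_fun \<A> f"
    using assms(7) by (auto simp: test_function_def K_def)
  have f0: "f x = 0" if "x \<notin> K" for x
    using that closure_subset[of "{x. f x \<noteq> 0}"] by (auto simp: K_def)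
  interpret test_function_coordinates \<A> L E A T S \<mu> M N f K Q
    by unfold_locales (use assms K K_ball f f0 in auto)
  \<comment> \<open>The indicator of the ball is 1 on \<open>K\<close>, and off \<open>K\<close> the
    integrand is 0.\<close>
  have ball: "(LINT x:quasi_ball N R|M. \<phi> x) = (LINT x|M. \<psi> x)"
    if "\<And>x. \<phi> x = \<psi> x" "\<And>x. x \<notin> K \<Longrightarrow> \<psi> x = 0" for \<phi> \<psi> :: "'g \<Rightarrow> real"
    unfolding set_lebesgue_integral_def
    using that K_ball by (intro Bochner_Integration.integral_cong) (auto simp: indicator_def)
  \<comment> \<open>At the unit both sides are 0, by the conventions \<open>ln 0 = 0\<close> and
    division by 0.\<close>
  have "cmod (ln (N x) * radial_deriv E A N f x) = slope x" for x
    using radial_deriv_eq[of x] N_nonneg[of x]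
    by (cases "N x = 0") (auto simp: slope_def norm_mult divide_simps)
  then have 1: "(LINT x:quasi_ball N R|M. cmod (ln (N x) * radial_deriv E A N f x) powr Q) =
      (LINT x|M. slope x powr Q)"
    by (intro ball) (auto simp: slope_zero)
  have 2: "(LINT x:quasi_ball N R|M. N x powr (Q / (Q - 1)) * cmod (f x) powr (Q / (Q - 1))) =
      (LINT x|M. (N x * cmod (f x)) powr (Q / (Q - 1)))"
    using N_nonneg by (intro ball) (auto simp: powr_mult f0)
  have 3: "(LINT x:quasi_ball N R|M. (cmod (f x))\<^sup>2) = (LINT x|M. (cmod (f x))\<^sup>2)"
    by (intro ball) (auto simp: f0)
  show ?thesis
    unfolding 1 2 3 using uncertainty_inequality assms(3) by (simp add: field_simps)
qed

end
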